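(* Consider the projected stochastic subgradient method with soft separation described in the context, run at a fixed temperature $w>0$, and suppose that, with respect to any fixed operator norm (e.g. $\|\cdot\|_{\infty\to\infty}$), $\sup_{x\in\mathcal X}\|(\mathrm{Id}-P_x+\mathbf 1p_x^\top)^{-1}\|\le C_*$ for a constant $0<C_*<\infty$. Suppose that the step sizes $\{\alpha_k\}$ are positive and nonincreasing. Let $F_w^\star:=\min_{x\in\mathcal X}F_w(x)$, let $x^\star\in\operatorname{argmin}_{x\in\mathcal X}F_w(x)$, and let $\bar x_n$ be the weighted average iterate returned by the method after $n$ iterations. Then, for any $n\ge1$, $$0\le\mathbb E[F_w(\bar x_n)]-F_w^\star\le\frac{\mathbb E[\|x_0-x^\star\|^2]+C_0+\big(C_1+3(L_f+L_Q')^2\big)\sum_{k=1}^n\alpha_k^2}{2\sum_{k=1}^n\alpha_k},$$ where $C_0=4B_Z\alpha_1$ and $C_1=2(L_Q'+L_f)(L_PB_Z+L_Z)$ with $$B_Z:=2C_*DL_Q',\qquad L_Z:=C_*\Big(2L_Q'+\frac{2D(L_Q')^2}{w}\Big)+2C_*^2DL_Q'\Big(L_P+\frac{2L_Q'}{w}\Big).$$ Moreover, if the step sizes are chosen as $\alpha_n\propto1/\sqrt{n+1}$, then the method achieves a convergence rate to $F_w^\star$ in the order of $O\big((C_*+C_*^2/w)\,n^{-1/2}\log n\big)$ for the step-size average and $O\big((C_*+C_*^2/w)\,n^{-1/2}\big)$ for the linear average, respectively.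
   Context: Problem. $\mathcal X\subseteq\mathbb R^{d_x}$ is compact and convex with $\|x-x'\|_1\le D$ for all $x,x'\in\mathcal X$. The function $f$ is convex and $L_f$-Lipschitz on an open neighborhood of $\mathcal X$. $\mathcal I$ is a finite index set and $\Xi=\{\xi^{(i)}:i\in\mathcal I\}\subset\mathbb R^{d_\xi}$. For matrices $G,E,U$ and vectors $b,h$, $Q(x,\xi):=\min_y\{b^\top y:\ Gy+Ex+U\xi-h\ge0\}$, assumed finite for every $(x,\xi)\in\mathcal X\times\Xi$. By LP duality $Q(x,\xi^{(i)})=\max\{\pi^\top(h-Ex-U\xi^{(i)}):\pi\ge0,\ G^\top\pi=b\}$; $\pi^\star(x,i)$ denotes a maximizer, chosen to minimize $\|E^\top\pi\|_1$ in case of alternative optimal solutions. $L_Q'$ is a constant such that every $Q(\cdot,\xi^{(i)})$ is $L_Q'$-Lipschitz on $\mathcal X$ and the (measurable) selection satisfies $\|E^\top\pi^\star(x,i)\|\le L_Q'$ for all $x\in\mathcal X$, $i\in\mathcal I$. $g_f(x)\in\partial f(x)$ is a bounded measurable subgradient selection, and $Z_x(i):=g_f(x)-E^\top\pi^\star(x,i)$. $\|\cdot\|$ on vectors is the Euclidean norm. Mellowmax surrogate. For $w>0$, $F_w(x):=f(x)+w\log\big(\frac1{|\mathcal I|}\sum_{i\in\mathcal I}\exp\{Q(x,\xi^{(i)})/w\}\big)$ and $p_x(i):=\exp(Q(x,\xi^{(i)})/w)/\sum_{j\in\mathcal I}\exp(Q(x,\xi^{(j)})/w)$ (a column probability vector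 $p_x$). Kernel. $q(\cdot\mid\cdot)>0$ is a fixed proposal kernel on $\mathcal I$ (with $\sum_jq(j\mid i)=1$). With $r_x(i,j):=\frac{p_x(j)q(i\mid j)}{p_x(i)q(j\mid i)}$, the acceptance probability is either Metropolis–Hastings, $A_x(i,j)=\min\{1,r_x(i,j)\}$, or Barker, $A_x(i,j)=r_x(i,j)/(1+r_x(i,j))$. The transition matrix is $P_x(i,j)=q(j\mid i)A_x(i,j)$ for $j\ne i$ and $P_x(i,i)=1-\sum_{k\ne i}q(k\mid i)A_x(i,k)$; $p_x$ is its stationary distribution. $L_P$ denotes the Lipschitz modulus of $P_x$, such that $\sum_{j\in\mathcal I}|P_x(i,j)-P_{x'}(i,j)|\le L_P\|x-x'\|$ for all $i\in\mathcal I$ and $x,x'\in\mathcal X$ (one may take $L_P=L_Q'/w$ for Barker and $L_P=4L_Q'/w$ for Metropolis–Hastings). Method. Start from $x_0\in\mathcal X$ and $I_0$ uniform on $\mathcal I$. For $n=0,1,2,\dots$: conditionally on the past, draw $I_{n+1}\sim P_{x_n}(I_n,\cdot)$ and set $x_{n+1}=\Pi_{\mathcal X}\big(x_n-\alpha_{n+1}Z_{x_n}(I_{n+1})\big)$, where $\Pi_{\mathcal X}$ is Euclidean projection onto $\mathcal X$. The weighted average iterate returned after $n$ iterations is either the step-size average $\big(\sum_{k=1}^n\alpha_kx_k\big)/\big(\sum_{k=1}^n\alpha_k\big)$ or the linear average $\big(\sum_{k=1}^nkx_k\big)/\big(\sum_{k=1}^nk\big)$.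
   Formalization: For an operator norm other than the ∞→∞ norm, C_* in the explicit constants is multiplied by a factor κ comparing the ∞→∞ norm to it; the explicit upper bound is stated only for the step-size average. As printed, the bound fails for general norms and for the linear average. *)

theory Defs
  imports "HOL-Probability.Probability"
begin

definition l1norm :: "real^'n \<Rightarrow> real" where
  "l1norm v = (\<Sum>k\<in>UNIV. \<bar>v $ k\<bar>)"

definition subdifferential :: "'a::real_inner set \<Rightarrow> ('a \<Rightarrow> real) \<Rightarrow> 'a \<Rightarrow> 'a set" where
  "subdifferential S f x = {g. \<forall>y\<in>S. f x + g \<bullet> (y - x) \<le> f y}"

definition is_norm :: "('a::real_vector \<Rightarrow> real) \<Rightarrow> bool" where
  "is_norm N \<longleftrightarrow>
     (\<forall>v. N v = 0 \<longleftrightarrow> v = 0) \<and>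
     (\<forall>c v. N (c *\<^sub>R v) = \<bar>c\<bar> * N v) \<and>
     (\<forall>u v. N (u + v) \<le> N u + N v)"

text \<open>The operator norm of a square matrix induced by an arbitrary vector norm; it has the shape
  of \<^const>\<open>onorm\<close>, which is tied to the Euclidean norm here. The choice
  \<^term>\<open>N = infnorm\<close> gives the norm of operators from sup-norm to sup-norm.\<close>

definition opnorm :: "(real^'n \<Rightarrow> real) \<Rightarrow> real^'n^'n \<Rightarrow> real" where
  "opnorm N A = (SUP v. N (A *v v) / N v)"

datatype acceptance = Metropolis_Hastings | Barker

text \<open>The index set is the finite type \<open>'i\<close>. The open set \<^term>\<open>nbhd\<close> is the neighbourhood of the
  feasible set on which the first-stage cost is convex and Lipschitz, and \<open>proposal j i\<close> is the
  proposal probability $q(j \mid i)$ of moving from \<open>i\<close> to \<open>j\<close>.\<close>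

record ('x::finite, 'z::finite, 'y::finite, 'm::finite, 'i) problem =
  feas :: "(real^'x) set"
  nbhd :: "(real^'x) set"
  cost :: "real^'x \<Rightarrow> real"
  scen :: "'i \<Rightarrow> real^'z"
  Gmat :: "real^'y^'m"
  Emat :: "real^'x^'m"
  Umat :: "real^'z^'m"
  bvec :: "real^'y"
  hvec :: "real^'m"
  subgrad :: "real^'x \<Rightarrow> real^'x"
  dualsel :: "real^'x \<Rightarrow> 'i \<Rightarrow> real^'m"
  proposal :: "'i \<Rightarrow> 'i \<Rightarrow> real"
  accept :: acceptance


section \<open>Recourse function and dual solutions\<close>

definition recourse_set ::
    "('x::finite, 'z::finite, 'y::finite, 'm::finite, 'i) problem \<Rightarrow> real^'x \<Rightarrow> real^'z \<Rightarrow> (real^'y) set" where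
  "recourse_set pr x \<xi> =
     {y. \<forall>k. 0 \<le> (Gmat pr *v y + Emat pr *v x + Umat pr *v \<xi> - hvec pr) $ k}"

text \<open>A linear program with finite optimal value attains it, so the infimum is the minimum
  whenever \<open>recourse_finite\<close> holds.\<close>

definition recourse ::
    "('x::finite, 'z::finite, 'y::finite, 'm::finite, 'i) problem \<Rightarrow> real^'x \<Rightarrow> real^'z \<Rightarrow> real" where
  "recourse pr x \<xi> = (INF y\<in>recourse_set pr x \<xi>. bvec pr \<bullet> y)"

definition recourse_finite ::
    "('x::finite, 'z::finite, 'y::finite, 'm::finite, 'i) problem \<Rightarrow> real^'x \<Rightarrow> real^'z \<Rightarrow> bool" where
  "recourse_finite pr x \<xi> \<longleftrightarrow>
     recourse_set pr x \<xi> \<noteq> {} \<and> bdd_below ((\<lambda>y. bvec pr \<bullet> y) ` recourse_set pr x \<xi>)"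

definition dual_feasible ::
    "('x::finite, 'z::finite, 'y::finite, 'm::finite, 'i) problem \<Rightarrow> real^'m \<Rightarrow> bool" where
  "dual_feasible pr p \<longleftrightarrow> (\<forall>k. 0 \<le> p $ k) \<and> transpose (Gmat pr) *v p = bvec pr"

definition dual_optimal ::
    "('x::finite, 'z::finite, 'y::finite, 'm::finite, 'i) problem \<Rightarrow> real^'x \<Rightarrow> 'i \<Rightarrow> real^'m \<Rightarrow> bool" where
  "dual_optimal pr x i =
     is_arg_max (\<lambda>p. p \<bullet> (hvec pr - Emat pr *v x - Umat pr *v scen pr i)) (dual_feasible pr)"


section \<open>Surrogate, stationary law and transition kernel\<close>

definition surrogate ::
    "('x::finite, 'z::finite, 'y::finite, 'm::finite, 'i::finite) problem \<Rightarrow> real \<Rightarrow> real^'x \<Rightarrow> real" where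
  "surrogate pr w x = cost pr x +
     w * ln (1 / real CARD('i) * (\<Sum>i\<in>UNIV. exp (recourse pr x (scen pr i) / w)))"

definition gibbs ::
    "('x::finite, 'z::finite, 'y::finite, 'm::finite, 'i::finite) problem \<Rightarrow> real \<Rightarrow> real^'x \<Rightarrow> 'i \<Rightarrow> real" where
  "gibbs pr w x i =
     exp (recourse pr x (scen pr i) / w) / (\<Sum>j\<in>UNIV. exp (recourse pr x (scen pr j) / w))"

definition ratio ::
    "('x::finite, 'z::finite, 'y::finite, 'm::finite, 'i::finite) problem \<Rightarrow> real \<Rightarrow> real^'x \<Rightarrow> 'i \<Rightarrow> 'i \<Rightarrow> real" where
  "ratio pr w x i j = gibbs pr w x j * proposal pr i j / (gibbs pr w x i * proposal pr j i)"

definition acc_prob ::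
    "('x::finite, 'z::finite, 'y::finite, 'm::finite, 'i::finite) problem \<Rightarrow> real \<Rightarrow> real^'x \<Rightarrow> 'i \<Rightarrow> 'i \<Rightarrow> real" where
  "acc_prob pr w x i j = (case accept pr of
       Metropolis_Hastings \<Rightarrow> min 1 (ratio pr w x i j)
     | Barker \<Rightarrow> ratio pr w x i j / (1 + ratio pr w x i j))"

definition kernel ::
    "('x::finite, 'z::finite, 'y::finite, 'm::finite, 'i::finite) problem \<Rightarrow> real \<Rightarrow> real^'x \<Rightarrow> real^'i^'i" where
  "kernel pr w x = (\<chi> i j.
     if j = i then 1 - (\<Sum>k\<in>UNIV - {i}. proposal pr k i * acc_prob pr w x i k)
     else proposal pr j i * acc_prob pr w x i j)"

definition fundamental_matrix ::
    "('x::finite, 'z::finite, 'y::finite, 'm::finite, 'i::finite) problem \<Rightarrow> real \<Rightarrow> real^'x \<Rightarrow> real^'i^'i" where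
  "fundamental_matrix pr w x = matrix_inv (mat 1 - kernel pr w x + (\<chi> i j. gibbs pr w x j))"

definition kernel_lipschitz ::
    "('x::finite, 'z::finite, 'y::finite, 'm::finite, 'i::finite) problem \<Rightarrow> real \<Rightarrow> real \<Rightarrow> bool" where
  "kernel_lipschitz pr w LP \<longleftrightarrow> 0 \<le> LP \<and>
     (\<forall>i. \<forall>x\<in>feas pr. \<forall>x'\<in>feas pr.
        (\<Sum>j\<in>UNIV. \<bar>kernel pr w x $ i $ j - kernel pr w x' $ i $ j\<bar>) \<le> LP * norm (x - x'))"


section \<open>Standing assumptions\<close>

definition standing ::
    "('x::finite, 'z::finite, 'y::finite, 'm::finite, 'i::finite) problem \<Rightarrow> real \<Rightarrow> real \<Rightarrow> real \<Rightarrow> bool" where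
  "standing pr D Lf LQ \<longleftrightarrow>
     compact (feas pr) \<and> convex (feas pr) \<and>
     (\<forall>x\<in>feas pr. \<forall>x'\<in>feas pr. l1norm (x - x') \<le> D) \<and>
     open (nbhd pr) \<and> feas pr \<subseteq> nbhd pr \<and>
     convex_on (nbhd pr) (cost pr) \<and> Lf-lipschitz_on (nbhd pr) (cost pr) \<and>
     (\<forall>x\<in>feas pr. \<forall>i. recourse_finite pr x (scen pr i)) \<and>
     (\<forall>i. LQ-lipschitz_on (feas pr) (\<lambda>x. recourse pr x (scen pr i))) \<and>
     (\<forall>x\<in>feas pr. \<forall>i.
        is_arg_min (\<lambda>p. l1norm (transpose (Emat pr) *v p)) (dual_optimal pr x i) (dualsel pr x i)) \<and>
     (\<forall>i. (\<lambda>x. dualsel pr x i) \<in> borel_measurable (restrict_space borel (feas pr))) \<and>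
     (\<forall>x\<in>feas pr. \<forall>i. norm (transpose (Emat pr) *v dualsel pr x i) \<le> LQ) \<and>
     (\<forall>x\<in>feas pr. subgrad pr x \<in> subdifferential (nbhd pr) (cost pr) x) \<and>
     subgrad pr \<in> borel_measurable (restrict_space borel (feas pr)) \<and>
     bounded (subgrad pr ` feas pr) \<and>
     (\<forall>i j. 0 < proposal pr j i) \<and> (\<forall>i. (\<Sum>j\<in>UNIV. proposal pr j i) = 1)"


section \<open>The method\<close>

definition direction ::
    "('x::finite, 'z::finite, 'y::finite, 'm::finite, 'i) problem \<Rightarrow> real^'x \<Rightarrow> 'i \<Rightarrow> real^'x" where
  "direction pr x i = subgrad pr x - transpose (Emat pr) *v dualsel pr x i"

text \<open>The past up to time \<open>n\<close> is the \<open>n\<close>-th member of an arbitrary filtration to which the process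
  is adapted; the iterates after \<^term>\<open>x 0\<close> are adapted by the recursion. The initial point may be
  random.\<close>

definition method_run ::
    "('x::finite, 'z::finite, 'y::finite, 'm::finite, 'i::finite) problem \<Rightarrow> real \<Rightarrow> (nat \<Rightarrow> real) \<Rightarrow>
     'w measure \<Rightarrow> (nat \<Rightarrow> 'w measure) \<Rightarrow> (nat \<Rightarrow> 'w \<Rightarrow> real^'x) \<Rightarrow> (nat \<Rightarrow> 'w \<Rightarrow> 'i) \<Rightarrow> bool" where
  "method_run pr w \<alpha> M \<F> x I \<longleftrightarrow>
     prob_space M \<and> filtration (space M) \<F> \<and> (\<forall>n. subalgebra M (\<F> n)) \<and>
     x 0 \<in> borel_measurable (\<F> 0) \<and> (\<forall>n. I n \<in> measurable (\<F> n) (count_space UNIV)) \<and>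
     (\<forall>\<omega>\<in>space M. x 0 \<omega> \<in> feas pr) \<and>
     (\<forall>i. measure M {\<omega>\<in>space M. I 0 \<omega> = i} = 1 / real CARD('i)) \<and>
     (\<forall>n j. AE \<omega> in M.
        real_cond_exp M (\<F> n) (indicator {\<omega>\<in>space M. I (Suc n) \<omega> = j}) \<omega>
          = kernel pr w (x n \<omega>) $ I n \<omega> $ j) \<and>
     (\<forall>n. \<forall>\<omega>\<in>space M. x (Suc n) \<omega> =
        closest_point (feas pr) (x n \<omega> - \<alpha> (Suc n) *\<^sub>R direction pr (x n \<omega>) (I (Suc n) \<omega>)))"

definition weighted_average :: "(nat \<Rightarrow> real) \<Rightarrow> (nat \<Rightarrow> 'a::real_vector) \<Rightarrow> nat \<Rightarrow> 'a" where
  "weighted_average c x n = (\<Sum>k=1..n. c k *\<^sub>R x k) /\<^sub>R (\<Sum>k=1..n. c k)"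

text \<open>Expected optimality gap of the average iterate with weights \<open>c\<close>: the weights \<open>c = \<alpha>\<close> give
  the step-size average and \<open>c = real\<close> the linear average.\<close>

definition expected_gap ::
    "('x::finite, 'z::finite, 'y::finite, 'm::finite, 'i::finite) problem \<Rightarrow> real \<Rightarrow>
     'w measure \<Rightarrow> (nat \<Rightarrow> real) \<Rightarrow> (nat \<Rightarrow> 'w \<Rightarrow> real^'x) \<Rightarrow> nat \<Rightarrow> real" where
  "expected_gap pr w M c x n =
     (\<integral>\<omega>. surrogate pr w (weighted_average c (\<lambda>k. x k \<omega>) n) \<partial>M) - (INF z\<in>feas pr. surrogate pr w z)"


section \<open>Constants\<close>

text \<open>The argument \<open>C\<close> has to bound the fundamental matrix from sup-norm to sup-norm, the norm that
  matches the row sums in \<open>kernel_lipschitz\<close>. From a bound \<open>Cs\<close> in the operator norm induced by \<open>N\<close>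
  one gets \<open>C = \<kappa> * Cs\<close>, where \<open>opnorm infnorm A \<le> \<kappa> * opnorm N A\<close> for all \<open>A\<close>; for
  \<open>N = infnorm\<close> take \<open>\<kappa> = 1\<close>.\<close>

definition B_Z :: "real \<Rightarrow> real \<Rightarrow> real \<Rightarrow> real" where
  "B_Z C D LQ = 2 * C * D * LQ"

definition L_Z :: "real \<Rightarrow> real \<Rightarrow> real \<Rightarrow> real \<Rightarrow> real \<Rightarrow> real" where
  "L_Z C D LQ LP w =
     C * (2 * LQ + 2 * D * LQ\<^sup>2 / w) + 2 * C\<^sup>2 * D * LQ * (LP + 2 * LQ / w)"

definition C_0 :: "real \<Rightarrow> real \<Rightarrow> real \<Rightarrow> real \<Rightarrow> real" where
  "C_0 C D LQ \<alpha>1 = 4 * B_Z C D LQ * \<alpha>1"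

definition C_1 :: "real \<Rightarrow> real \<Rightarrow> real \<Rightarrow> real \<Rightarrow> real \<Rightarrow> real \<Rightarrow> real" where
  "C_1 C D Lf LQ LP w = 2 * (LQ + Lf) * (LP * B_Z C D LQ + L_Z C D LQ LP w)"

end

theory Submission
  imports Defs
begin

text \<open>Write $\nu_x$ for the solution of the Poisson equation of the kernel $P_x$ at the frozen point $x$ and
  $m_x = P_x \nu_x$. The noise of a step is $\nu_{x_{k-1}}(I_k) - m_{x_{k-1}}(I_k)$, and its first term has the
  same mean as $m_{x_{k-1}}(I_{k-1})$. As $m_x$ is Lipschitz in $x$ and the iterates move by at most
  $\alpha_k (L_f + L_Q')$, the mean noise telescopes up to an error of order $\alpha_k$, and
  summation by parts against the step sizes, or against the weights $k$, gives both bounds. In the first average $x_k$ has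
  the weight $\alpha_k$ although the step from $x_k$ is $\alpha_{k+1}$; exchanging $F_w(x_{k-1})$ for
  $F_w(x_k)$ costs two of the three terms $(L_f + L_Q')^2 \alpha_k^2$.\<close>

text \<open>The chain is never stationary: its kernel moves with the iterate, so the directions are
  biased and the bias has to be paid along the way. Bounding the Poisson solution costs one inverse
  matrix and its variation in the point costs two, hence \<open>C\<close> and
  \<open>C\<^sup>2\<close> in \<open>B_Z\<close> and \<open>L_Z\<close>. The mean prediction lies in
  an interval of width \<open>2 * BZ\<close>, and summation by parts charges this width once, at
  weight \<open>2 * \<alpha> 1\<close>: this is \<open>C_0\<close>. \<open>C_1\<close> is twice the
  step length per unit of step size times the Lipschitz constant of the prediction.
  \<open>recourse\<close> is a primal infimum while the direction uses a dual solution, so LP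
  duality is what makes the direction a subgradient. Row sums of kernel differences pair with the
  sup-norm; hence the analysis runs with a sup-norm bound, and a general operator norm enters only
  at the end, with \<kappa> * C in place of C. The constant of the rates is chosen before the
  problem and the temperature, so there the modulus of the kernel has to be explicit:
  \<open>4 * LQ / w\<close> for both acceptance rules.\<close>

section \<open>Linear programming duality\<close>

text \<open>If no dual solution has value at least \<open>v\<close>, then \<^term>\<open>(b, v)\<close> can be separated from the closed
  cone of all pairs of a dual constraint vector and a number below the dual objective; the
  separating vector is either a primal point of value below \<open>v\<close> or a direction of descent.\<close>

lemma lp_strong_duality:
  fixes G :: "real^'y^'m" and b :: "real^'y" and c :: "real^'m"
  assumes y0: "\<And>k. c $ k \<le> (G *v y0) $ k"
    and lb: "\<And>y. (\<And>k. c $ k \<le> (G *v y) $ k) \<Longrightarrow> v \<le> b \<bullet> y"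
  obtains p where "\<And>k. 0 \<le> p $ k" "transpose G *v p = b" "v \<le> p \<bullet> c"
proof -
  \<comment> \<open>Separation needs a closed cone. A finitely generated cone is closed, so the hull
    of the finite set \<open>S\<close> is separated from \<open>(b, v)\<close>, and \<open>T\<close>
    only has to contain it. The generator \<open>(0, -1)\<close> stands for the slack
    \<open>s\<close> and later forces \<open>t \<le> 0\<close>.\<close>
  define S :: "((real^'y) \<times> real) set" where "S = insert (0, -1) (range (\<lambda>k. (row k G, c $ k)))"
  define T where "T = {(transpose G *v p, p \<bullet> c - s) | p s. (\<forall>k. 0 \<le> p $ k) \<and> 0 \<le> s}"
  have T0: "(0, 0) \<in> T"
    unfolding T_def by (intro CollectI exI[of _ 0]) auto
  have "convex_cone T"
    unfolding convex_cone_iff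
  proof (intro conjI ballI allI impI)
    show "0 \<in> T" using T0 by (simp add: zero_prod_def)
  next
    fix x y assume "x \<in> T" "y \<in> T"
    then obtain p s q t where "x = (transpose G *v p, p \<bullet> c - s)" "y = (transpose G *v q, q \<bullet> c - t)"
      "\<forall>k. 0 \<le> p $ k" "\<forall>k. 0 \<le> q $ k" "0 \<le> s" "0 \<le> t"
      by (auto simp: T_def)
    then show "x + y \<in> T" unfolding T_def
      by (intro CollectI exI[of _ "p + q"] exI[of _ "s + t"])
        (auto simp: algebra_simps matrix_vector_right_distrib inner_add_left)
  next
    fix x and a :: real assume "x \<in> T" "0 \<le> a"
    then obtain p s where "x = (transpose G *v p, p \<bullet> c - s)" "\<forall>k. 0 \<le> p $ k" "0 \<le> s"
      by (auto simp: T_def)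
    with \<open>0 \<le> a\<close> show "a *\<^sub>R x \<in> T" unfolding T_def
      by (intro CollectI exI[of _ "a *\<^sub>R p"] exI[of _ "a * s"])
        (auto simp: algebra_simps matrix_vector_mult_scaleR)
  qed
  moreover have "S \<subseteq> T"
  proof -
    have "(row k G, c $ k) \<in> T" for k
    proof -
      have "transpose G *v axis k 1 = row k G"
        by (simp only: matrix_vector_mult_basis column_transpose)
      moreover have "axis k 1 \<bullet> c = c $ k" by (simp add: inner_axis')
      moreover have "\<forall>j. 0 \<le> (axis k 1 :: real^'m) $ j" by (simp add: axis_def)
      ultimately show ?thesis
        unfolding T_def by (intro CollectI exI[of _ "axis k 1"] exI[of _ 0]) simp
    qed
    moreover have "(0, -1) \<in> T"
      unfolding T_def by (intro CollectI exI[of _ 0] exI[of _ 1]) auto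
    ultimately show ?thesis by (auto simp: S_def)
  qed
  ultimately have hull: "convex_cone hull S \<subseteq> T" by (simp add: hull_minimal)
  have "(b, v) \<in> convex_cone hull S"
  proof (rule ccontr)
    assume "(b, v) \<notin> convex_cone hull S"
    moreover have "closed (convex_cone hull S)"
      by (rule closed_convex_cone_hull) (simp add: S_def)
    ultimately obtain a \<beta> where a: "a \<bullet> (b, v) < \<beta>" "\<And>x. x \<in> convex_cone hull S \<Longrightarrow> \<beta> < a \<bullet> x"
      using separating_hyperplane_closed_point convex_convex_cone_hull by metis
    have "\<beta> < 0" using a(2)[OF convex_cone_hull_contains_0] by simp
    \<comment> \<open>A functional bounded below on a cone is nonnegative there: otherwise a
      positive multiple of \<open>x\<close> would reach the value \<open>\<beta>\<close>
      exactly.\<close>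
    have nonneg: "0 \<le> a \<bullet> x" if "x \<in> S" for x
    proof (rule ccontr)
      assume "\<not> 0 \<le> a \<bullet> x"
      then have "(\<beta> / (a \<bullet> x)) *\<^sub>R x \<in> convex_cone hull S"
        using \<open>\<beta> < 0\<close> that by (intro convex_cone_hull_mul hull_inc) (auto simp: divide_nonpos_neg)
      from a(2)[OF this] \<open>\<not> 0 \<le> a \<bullet> x\<close> show False by auto
    qed
    obtain y t where yt: "a = (y, t)" by (cases a)
    have t: "t \<le> 0" using nonneg[of "(0, -1)"] by (simp add: S_def yt)
    have rows: "0 \<le> (G *v y) $ k + t * c $ k" for k
      using nonneg[of "(row k G, c $ k)"]
      by (simp add: S_def yt matrix_vector_mul_component row_def inner_commute)
    have neg: "y \<bullet> b + t * v < 0" using a(1) \<open>\<beta> < 0\<close> by (simp add: yt)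
    show False
    proof (cases "t = 0")
      case True
      \<comment> \<open>The step length along the descent direction \<open>y\<close> at which the
        objective, starting from \<open>y0\<close>, has dropped to \<open>v - 1\<close>.\<close>
      define r where "r = (b \<bullet> y0 - v + 1) / - (y \<bullet> b)"
      have "v \<le> b \<bullet> y0" by (rule lb[OF y0])
      then have r: "0 \<le> r" using neg True by (simp add: r_def divide_simps)
      have "c $ k \<le> (G *v (y0 + r *\<^sub>R y)) $ k" for k
      proof -
        have "0 \<le> r * (G *v y) $ k" using rows[of k] r True by simp
        then show ?thesis
          using y0[of k] by (simp add: matrix_vector_right_distrib matrix_vector_mult_scaleR)
      qed
      then have "v \<le> b \<bullet> (y0 + r *\<^sub>R y)" by (rule lb)
      moreover have "r * (b \<bullet> y) = - (b \<bullet> y0 - v + 1)"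
        using neg True by (simp add: r_def inner_commute)
      ultimately show False by (simp add: inner_add_right)
    next
      case False
      then have t: "t < 0" using t by simp
      have "c $ k \<le> (G *v ((- 1 / t) *\<^sub>R y)) $ k" for k
        using rows[of k] t by (simp add: matrix_vector_mult_scaleR divide_simps del: scaleR_minus_left)
          (auto simp: algebra_simps)
      then have "v \<le> b \<bullet> ((- 1 / t) *\<^sub>R y)" by (rule lb)
      then show False using neg t by (simp add: divide_simps inner_commute) (auto simp: algebra_simps)
    qed
  qed
  with hull have "(b, v) \<in> T" by blast
  then obtain p s where "transpose G *v p = b" "v = p \<bullet> c - s" "\<forall>k. 0 \<le> p $ k" "0 \<le> s"
    by (auto simp: T_def)
  then show ?thesis by (intro that) auto
qed


section \<open>Operator norms\<close>

text \<open>At \<open>v = 0\<close> the quotient is \<open>0 / 0 = 0\<close>, so the supremum may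
  range over all vectors. Since the value is the same for every norm, the identity matrix later
  shows \<open>1 \<le> \<kappa>\<close>.\<close>

lemma opnorm_mat_1:
  fixes N :: "real^'i::finite \<Rightarrow> real"
  assumes "is_norm N"
  shows "opnorm N (mat 1) = 1"
proof -
  have *: "N v / N v = (if v = 0 then 0 else 1)" for v
    using assms by (auto simp: is_norm_def)
  have "1 = N (mat 1 *v axis undefined 1) / N (axis undefined 1)"
    by (simp only: matrix_vector_mul_lid *) (simp add: axis_eq_0_iff)
  then show ?thesis
    unfolding opnorm_def by (intro cSup_eq_maximum) (auto simp del: matrix_vector_mult_basis simp: * split: if_splits)
qed

lemma is_norm_infnorm: "is_norm (infnorm :: real^'i::finite \<Rightarrow> real)"
  by (auto simp: is_norm_def infnorm_eq_0 infnorm_mul infnorm_triangle)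

text \<open>A supremum of reals bounds its members only if the set is bounded above; equivalence of
  the sup-norm and the Euclidean norm supplies such a bound \<open>K\<close>.\<close>

lemma infnorm_le_opnorm:
  fixes A :: "real^'i::finite^'i"
  shows "infnorm (A *v v) \<le> opnorm infnorm A * infnorm v"
proof (cases "v = 0")
  case True
  then show ?thesis by (simp add: infnorm_0)
next
  case False
  define K where "K = onorm ((*v) A) * sqrt (DIM(real^'i))"
  have K: "infnorm (A *v u) \<le> K * infnorm u" for u
  proof -
    have "infnorm (A *v u) \<le> norm (A *v u)" by (rule infnorm_le_norm)
    also have "\<dots> \<le> onorm ((*v) A) * norm u" by (intro onorm) auto
    also have "\<dots> \<le> onorm ((*v) A) * (sqrt (DIM(real^'i)) * infnorm u)"
      by (intro mult_left_mono norm_le_infnorm onorm_pos_le) auto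
    finally show ?thesis by (simp add: K_def mult.assoc)
  qed
  have "0 \<le> K" by (simp add: K_def onorm_pos_le)
  have "bdd_above (range (\<lambda>u. infnorm (A *v u) / infnorm u))"
  proof (rule bdd_aboveI2)
    show "infnorm (A *v u) / infnorm u \<le> K" for u
      using K[of u] \<open>0 \<le> K\<close> infnorm_pos_le[of u] by (cases "infnorm u = 0") (auto simp: field_simps)
  qed
  then have "infnorm (A *v v) / infnorm v \<le> opnorm infnorm A"
    unfolding opnorm_def by (intro cSUP_upper) auto
  with False show ?thesis by (simp add: field_simps infnorm_pos_lt)
qed

lemma infnorm_le_cart:
  fixes v :: "real^'i::finite"
  assumes "\<And>i. \<bar>v $ i\<bar> \<le> B"
  shows "infnorm v \<le> B"
  unfolding infnorm_cart using assms by (intro cSup_least) auto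

lemma opnorm_infnorm_component:
  fixes A :: "real^'i::finite^'i"
  assumes "opnorm infnorm A \<le> C" "\<And>i. \<bar>v $ i\<bar> \<le> B"
  shows "\<bar>(A *v v) $ i\<bar> \<le> C * B"
proof -
  \<comment> \<open>A single nonzero vector shows that the operator norm, and so \<open>C\<close>,
    is nonnegative, which the product bound below requires.\<close>
  have "0 \<le> infnorm (A *v axis undefined 1)" by (rule infnorm_pos_le)
  also have "\<dots> \<le> opnorm infnorm A * infnorm (axis undefined 1 :: real^'i)" by (rule infnorm_le_opnorm)
  finally have "0 \<le> opnorm infnorm A * infnorm (axis undefined 1 :: real^'i)" .
  moreover have "0 < infnorm (axis undefined 1 :: real^'i)" by (simp add: infnorm_pos_lt axis_eq_0_iff)
  ultimately have "0 \<le> opnorm infnorm A" by (simp add: zero_le_mult_iff)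
  then have "0 \<le> C" using assms(1) by linarith
  have "\<bar>(A *v v) $ i\<bar> \<le> infnorm (A *v v)" by (rule component_le_infnorm_cart)
  also have "\<dots> \<le> opnorm infnorm A * infnorm v" by (rule infnorm_le_opnorm)
  also have "\<dots> \<le> C * B"
    using assms \<open>0 \<le> C\<close> by (intro mult_mono infnorm_le_cart infnorm_pos_le) auto
  finally show ?thesis .
qed


section \<open>Softmax weights and acceptance probabilities\<close>

definition softmax :: "('i::finite \<Rightarrow> real) \<Rightarrow> 'i \<Rightarrow> real" where
  "softmax s i = exp (s i) / (\<Sum>j\<in>UNIV. exp (s j))"

lemma sum_exp_pos: "0 < (\<Sum>j\<in>UNIV. exp (s j))" for s :: "'i::finite \<Rightarrow> real"
  by (intro sum_pos) auto

lemma softmax_pos: "0 < softmax s i"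
  by (simp add: softmax_def sum_exp_pos)

lemma sum_softmax: "(\<Sum>i\<in>UNIV. softmax s i) = 1"
  using sum_exp_pos[of s] by (simp add: softmax_def flip: sum_divide_distrib)

lemma abs_softmax_average_le:
  assumes "\<And>i. \<bar>u i\<bar> \<le> B"
  shows "\<bar>\<Sum>i\<in>UNIV. softmax s i * u i\<bar> \<le> B"
proof -
  have "\<bar>\<Sum>i\<in>UNIV. softmax s i * u i\<bar> \<le> (\<Sum>i\<in>UNIV. softmax s i * B)"
    using assms softmax_pos[of s]
    by (intro order_trans[OF sum_abs] sum_mono)
      (auto simp: abs_mult abs_of_pos intro!: mult_left_mono less_imp_le)
  then show ?thesis by (simp add: sum_softmax flip: sum_distrib_right)
qed

text \<open>Convexity of log-sum-exp, whose gradient is the softmax. The inequality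
  \<open>1 + u \<le> exp u\<close> is averaged over the softmax weights with
  \<open>u = t j - s j - m\<close>; centring by \<open>m\<close> makes the left side average to
  1.\<close>

lemma log_sum_exp_tangent:
  fixes s t :: "'i::finite \<Rightarrow> real"
  shows "ln (\<Sum>j\<in>UNIV. exp (s j)) + (\<Sum>j\<in>UNIV. softmax s j * (t j - s j)) \<le> ln (\<Sum>j\<in>UNIV. exp (t j))"
proof -
  define m where "m = (\<Sum>j\<in>UNIV. softmax s j * (t j - s j))"
  define S where "S = (\<Sum>j\<in>UNIV. exp (s j))"
  have S: "0 < S" by (simp add: S_def sum_exp_pos)
  have "1 = (\<Sum>j\<in>UNIV. softmax s j * (1 + (t j - s j - m)))"
  proof -
    have "(\<Sum>j\<in>UNIV. softmax s j * (1 + (t j - s j - m)))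
        = (\<Sum>j\<in>UNIV. softmax s j) * (1 - m) + m"
      unfolding m_def sum_distrib_right sum.distrib[symmetric] by (intro sum.cong) (auto simp: algebra_simps)
    then show ?thesis by (simp add: sum_softmax)
  qed
  also have "\<dots> \<le> (\<Sum>j\<in>UNIV. softmax s j * exp (t j - s j - m))"
    by (intro sum_mono mult_left_mono exp_ge_add_one_self less_imp_le softmax_pos)
  also have "\<dots> = (\<Sum>j\<in>UNIV. exp (t j)) / (S * exp m)"
    unfolding sum_divide_distrib softmax_def S_def[symmetric]
    by (intro sum.cong) (auto simp: exp_diff)
  finally have "S * exp m \<le> (\<Sum>j\<in>UNIV. exp (t j))" using S by (simp add: field_simps)
  then have "ln (S * exp m) \<le> ln (\<Sum>j\<in>UNIV. exp (t j))"
    using S by (subst ln_le_cancel_iff) (auto simp: sum_exp_pos)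
  then show ?thesis using S by (simp add: ln_mult S_def m_def)
qed

lemma softmax_lipschitz:
  fixes s t :: "'i::finite \<Rightarrow> real"
  assumes \<delta>: "\<And>i. \<bar>s i - t i\<bar> \<le> \<delta>"
  shows "(\<Sum>i\<in>UNIV. \<bar>softmax s i - softmax t i\<bar>) \<le> 2 * \<delta>"
proof -
  \<comment> \<open>The signs are frozen at the end points, so \<open>h\<close> is smooth along the
    segment from \<open>t\<close> to \<open>s\<close> and \<open>h 1 - h 0\<close> is the l1
    distance. The mean value theorem then leaves a softmax average of centred differences, each at
    most \<open>2 * \<delta>\<close>.\<close>
  define \<epsilon> where "\<epsilon> i = sgn (softmax s i - softmax t i)" for i
  define u where "u \<tau> i = t i + \<tau> * (s i - t i)" for \<tau> i
  define h where "h \<tau> = (\<Sum>i\<in>UNIV. \<epsilon> i * softmax (u \<tau>) i)" for \<tau>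
  define av where "av \<tau> = (\<Sum>j\<in>UNIV. softmax (u \<tau>) j * (s j - t j))" for \<tau>
  define h' where "h' \<tau> = (\<Sum>i\<in>UNIV. softmax (u \<tau>) i * (\<epsilon> i * (s i - t i - av \<tau>)))" for \<tau>
  have der: "((\<lambda>\<tau>. softmax (u \<tau>) i) has_real_derivative softmax (u \<tau>) i * (s i - t i - av \<tau>)) (at \<tau>)" for i \<tau>
  proof -
    define Z where "Z = (\<Sum>j\<in>UNIV. exp (u \<tau> j))"
    have Z: "0 < Z" by (simp add: Z_def sum_exp_pos)
    have av: "av \<tau> = (\<Sum>j\<in>UNIV. exp (u \<tau> j) * (s j - t j)) / Z"
      unfolding av_def softmax_def Z_def[symmetric] sum_divide_distrib by simp
    have "((\<lambda>\<tau>. exp (u \<tau> i) / (\<Sum>j\<in>UNIV. exp (u \<tau> j))) has_real_derivative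
       (exp (u \<tau> i) * (s i - t i) * Z - exp (u \<tau> i) * (\<Sum>j\<in>UNIV. exp (u \<tau> j) * (s j - t j))) / (Z * Z)) (at \<tau>)"
      unfolding Z_def u_def
      using sum_exp_pos[of "u \<tau>"] by (auto simp: u_def intro!: derivative_eq_intros)
    also have "(exp (u \<tau> i) * (s i - t i) * Z - exp (u \<tau> i) * (\<Sum>j\<in>UNIV. exp (u \<tau> j) * (s j - t j))) / (Z * Z)
       = softmax (u \<tau>) i * (s i - t i - av \<tau>)"
      unfolding av softmax_def Z_def[symmetric] using Z by (simp add: field_simps)
    finally show ?thesis by (simp add: softmax_def)
  qed
  have "(h has_real_derivative h' \<tau>) (at \<tau>)" for \<tau>
    unfolding h_def h'_def by (auto intro!: derivative_eq_intros der sum.cong)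
  then obtain z where z: "h 1 - h 0 = (1 - 0) * h' z"
    using MVT2[of 0 1 h h'] by auto
  have av: "\<bar>av z\<bar> \<le> \<delta>" unfolding av_def by (rule abs_softmax_average_le[OF \<delta>])
  have "(\<Sum>i\<in>UNIV. \<bar>softmax s i - softmax t i\<bar>) = h 1 - h 0"
    unfolding h_def u_def sum_subtractf[symmetric] \<epsilon>_def
    by (intro sum.cong) (auto simp: sgn_if)
  also have "\<dots> \<le> \<bar>h' z\<bar>" using z by simp
  also have "\<dots> \<le> 2 * \<delta>"
    unfolding h'_def
  proof (rule abs_softmax_average_le)
    fix i
    have "\<bar>s i - t i - av z\<bar> \<le> 2 * \<delta>" using av \<delta>[of i] by linarith
    moreover have "\<bar>\<epsilon> i\<bar> \<le> 1" by (simp add: \<epsilon>_def sgn_if)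
    ultimately show "\<bar>\<epsilon> i * (s i - t i - av z)\<bar> \<le> 2 * \<delta>"
      using mult_mono[of "\<bar>\<epsilon> i\<bar>" 1 "\<bar>s i - t i - av z\<bar>" "2 * \<delta>"] by (simp add: abs_mult)
  qed
  finally show ?thesis .
qed

definition acceptance_fun :: "acceptance \<Rightarrow> real \<Rightarrow> real" where
  "acceptance_fun a r = (case a of Metropolis_Hastings \<Rightarrow> min 1 r | Barker \<Rightarrow> r / (1 + r))"

lemma acceptance_fun_pos: "0 < r \<Longrightarrow> 0 < acceptance_fun a r"
  and acceptance_fun_le_1: "0 < r \<Longrightarrow> acceptance_fun a r \<le> 1"
  by (auto simp: acceptance_fun_def split: acceptance.split)

text \<open>The one identity behind detailed balance; through it Metropolis-Hastings and Barker are
  handled together.\<close>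

lemma acceptance_fun_balance:
  "0 < r \<Longrightarrow> acceptance_fun a r = r * acceptance_fun a (1 / r)"
  by (auto simp: acceptance_fun_def field_simps min_def split: acceptance.split)

text \<open>In the logarithm of the ratio both rules are 1-Lipschitz: acceptance increases with the
  ratio, by no larger a factor than the ratio itself. As it never exceeds 1, the increase is at most
  \<open>1 - exp (- d) \<le> d\<close>.\<close>

lemma acceptance_fun_lipschitz_aux:
  assumes "0 < r" "r \<le> r'" "r' \<le> exp d * r"
  shows "\<bar>acceptance_fun a r' - acceptance_fun a r\<bar> \<le> d"
proof -
  have "1 * r \<le> exp d * r" using assms by linarith
  then have d: "0 \<le> d" using assms(1) by (simp add: mult_le_cancel_right)
  have mono: "acceptance_fun a r \<le> acceptance_fun a r'"
    using assms by (auto simp: acceptance_fun_def field_simps split: acceptance.split)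
  have "acceptance_fun a r' \<le> exp d * acceptance_fun a r"
  proof (cases a)
    case Metropolis_Hastings
    then show ?thesis using assms d by (auto simp: acceptance_fun_def min_def)
  next
    case Barker
    have "r' / (1 + r') \<le> exp d * r / (1 + r)"
      using assms by (intro frac_le) auto
    then show ?thesis using Barker by (simp add: acceptance_fun_def)
  qed
  then have "exp (- d) * acceptance_fun a r' \<le> acceptance_fun a r"
    by (simp add: exp_minus field_simps)
  moreover have "(1 - exp (- d)) * acceptance_fun a r' \<le> d * 1"
    using exp_ge_add_one_self[of "- d"] d assms acceptance_fun_le_1[of r' a] acceptance_fun_pos[of r' a]
    by (intro mult_mono) auto
  ultimately show ?thesis using mono by (simp add: algebra_simps)
qed

lemma acceptance_fun_lipschitz:
  assumes "0 < c"
  shows "\<bar>acceptance_fun a (c * exp u) - acceptance_fun a (c * exp v)\<bar> \<le> \<bar>u - v\<bar>"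
proof (induction u v rule: linorder_wlog)
  case (le u v)
  have "\<bar>acceptance_fun a (c * exp v) - acceptance_fun a (c * exp u)\<bar> \<le> v - u"
    using assms le by (intro acceptance_fun_lipschitz_aux) (auto simp: exp_diff)
  then show ?case using le by linarith
next
  case (sym u v)
  then show ?case by (simp add: abs_minus_commute)
qed

lemma acceptance_fun_swap:
  assumes "0 < g" "0 < g'" "0 < q" "0 < q'"
  shows "g * (q * acceptance_fun a (g' * q' / (g * q))) = g' * (q' * acceptance_fun a (g * q / (g' * q')))"
  using assms by (subst acceptance_fun_balance) (auto simp: field_simps)

text \<open>\<open>matrix_inv\<close> is a choice operator and says nothing before an inverse is
  known to exist; for a square matrix a trivial kernel gives a left inverse, which is
  two-sided.\<close>

lemma matrix_inv_inverse:
  fixes A :: "real^'n^'n"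
  assumes "\<And>v. A *v v = 0 \<Longrightarrow> v = 0"
  shows "A *v (matrix_inv A *v v) = v" "matrix_inv A *v (A *v v) = v"
proof -
  have "\<exists>B. B ** A = mat 1"
    using assms by (simp add: matrix_left_invertible_ker)
  then have "\<exists>B. A ** B = mat 1 \<and> B ** A = mat 1"
    using matrix_left_right_inverse by blast
  then have "A ** matrix_inv A = mat 1 \<and> matrix_inv A ** A = mat 1"
    unfolding matrix_inv_def by (rule someI_ex)
  then show "A *v (matrix_inv A *v v) = v" "matrix_inv A *v (A *v v) = v"
    by (simp_all add: matrix_vector_mul_assoc)
qed


section \<open>The recourse function and the surrogate\<close>

locale soft_separation =
  fixes pr :: "('x::finite, 'z::finite, 'y::finite, 'm::finite, 'i::finite) problem"
    and w D Lf LQ :: real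
  assumes st: "standing pr D Lf LQ" and w: "0 < w"
begin

abbreviation "X \<equiv> feas pr"
abbreviation "Q i x \<equiv> recourse pr x (scen pr i)"
abbreviation "p \<equiv> gibbs pr w"
abbreviation "K \<equiv> kernel pr w"
abbreviation "F \<equiv> surrogate pr w"
abbreviation "Z \<equiv> direction pr"

lemma LQ_nonneg: "0 \<le> LQ" and Lf_nonneg: "0 \<le> Lf"
  using st lipschitz_on_nonneg unfolding standing_def by blast+

lemma Q_lipschitz: "x \<in> X \<Longrightarrow> y \<in> X \<Longrightarrow> \<bar>Q i x - Q i y\<bar> \<le> LQ * norm (x - y)"
  using st lipschitz_on_normD[of LQ X "Q i" x y] unfolding standing_def by auto

lemma norm_diff_le_D:
  assumes "x \<in> X" "y \<in> X"
  shows "norm (x - y) \<le> D"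
proof -
  have "norm (x - y) \<le> l1norm (x - y)" unfolding l1norm_def by (rule norm_le_l1_cart)
  also have "\<dots> \<le> D" using st assms unfolding standing_def by blast
  finally show ?thesis .
qed

lemma D_nonneg: "x \<in> X \<Longrightarrow> 0 \<le> D"
  using norm_diff_le_D[of x x] by simp

text \<open>The dual feasible set is the same for all points. Hence the selected
  \<open>\<pi>\<close> attains at least \<open>Q i x\<close> at \<open>x\<close> by strong duality
  and is still feasible at \<open>y\<close>, where weak duality bounds it by \<open>Q i y\<close>.
  The dual objective is affine in the point, with slope minus the transposed \<open>Emat pr\<close>
  applied to \<open>\<pi>\<close>.\<close>

lemma recourse_subgradient:
  assumes x: "x \<in> X" and y: "y \<in> X"
  shows "Q i x - (transpose (Emat pr) *v dualsel pr x i) \<bullet> (y - x) \<le> Q i y"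
proof -
  define \<pi> where "\<pi> = dualsel pr x i"
  define c where "c u = hvec pr - Emat pr *v u - Umat pr *v scen pr i" for u
  have mem: "u \<in> recourse_set pr v (scen pr i) \<longleftrightarrow> (\<forall>k. c v $ k \<le> (Gmat pr *v u) $ k)" for u v
  proof -
    have "0 \<le> a + e + f - h \<longleftrightarrow> h - e - f \<le> a" for a e f h :: real by linarith
    then show ?thesis by (simp add: recourse_set_def c_def)
  qed
  have fin: "recourse_finite pr v (scen pr i)" if "v \<in> X" for v
    using st that unfolding standing_def by blast
  have opt: "dual_optimal pr x i \<pi>"
    using st x unfolding standing_def is_arg_min_def \<pi>_def by blast
  then have dual: "\<And>k. 0 \<le> \<pi> $ k" "transpose (Gmat pr) *v \<pi> = bvec pr"
    by (auto simp: dual_optimal_def is_arg_max_def dual_feasible_def)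
  obtain y0 where y0: "y0 \<in> recourse_set pr x (scen pr i)"
    using fin[OF x] by (auto simp: recourse_finite_def)
  obtain r where r: "\<And>k. 0 \<le> r $ k" "transpose (Gmat pr) *v r = bvec pr" "Q i x \<le> r \<bullet> c x"
  proof (rule lp_strong_duality[where c = "c x" and b = "bvec pr" and v = "Q i x"])
    show "c x $ k \<le> (Gmat pr *v y0) $ k" for k using y0 mem by blast
    show "Q i x \<le> bvec pr \<bullet> u" if "\<And>k. c x $ k \<le> (Gmat pr *v u) $ k" for u
      unfolding recourse_def using fin[OF x] that mem by (auto simp: recourse_finite_def intro!: cINF_lower)
  qed blast
  have "Q i x \<le> \<pi> \<bullet> c x"
    using opt r unfolding dual_optimal_def is_arg_max_def dual_feasible_def c_def[symmetric] by force
  moreover have "\<pi> \<bullet> c y \<le> Q i y"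
    unfolding recourse_def
  proof (rule cINF_greatest)
    show "recourse_set pr y (scen pr i) \<noteq> {}" using fin[OF y] by (simp add: recourse_finite_def)
    fix u assume "u \<in> recourse_set pr y (scen pr i)"
    then have "\<pi> \<bullet> c y \<le> \<pi> \<bullet> (Gmat pr *v u)"
      unfolding inner_vec_def using dual(1) mem by (auto intro!: sum_mono mult_left_mono)
    also have "\<dots> = bvec pr \<bullet> u"
      by (simp flip: dual(2) add: dot_lmul_matrix)
    finally show "\<pi> \<bullet> c y \<le> bvec pr \<bullet> u" .
  qed
  moreover have "\<pi> \<bullet> c y = \<pi> \<bullet> c x - (transpose (Emat pr) *v \<pi>) \<bullet> (y - x)"
    by (simp add: dot_lmul_matrix c_def matrix_vector_mult_diff_distrib inner_diff_right)
  ultimately show ?thesis by (simp add: \<pi>_def)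
qed

lemma cost_subgradient:
  "x \<in> X \<Longrightarrow> y \<in> X \<Longrightarrow> cost pr x + subgrad pr x \<bullet> (y - x) \<le> cost pr y"
  using st unfolding standing_def subdifferential_def by blast

text \<open>A short move from \<open>x\<close> along \<open>g\<close> itself stays in the open
  neighbourhood, where the subgradient inequality and the Lipschitz bound can be compared.\<close>

lemma norm_subgrad_le:
  assumes x: "x \<in> X"
  shows "norm (subgrad pr x) \<le> Lf"
proof -
  define g where "g = subgrad pr x"
  have "open (nbhd pr)" "x \<in> nbhd pr" using st x unfolding standing_def by auto
  then obtain e where e: "0 < e" "ball x e \<subseteq> nbhd pr" by (meson open_contains_ball)
  \<comment> \<open>The summand 1 keeps the denominator positive when \<open>g = 0\<close>; the move
    has length below \<open>e / 2\<close>.\<close>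
  define t where "t = e / (2 * (norm g + 1))"
  have t: "0 < t" using e by (auto simp: t_def intro!: divide_pos_pos add_nonneg_pos)
  have "t * norm g < e"
  proof -
    have "e * norm g < e * (2 * (norm g + 1))" using e by (intro mult_strict_left_mono) (auto simp: add_nonneg_pos)
    then show ?thesis by (simp add: t_def divide_less_eq add_nonneg_pos)
  qed
  then have y: "x + t *\<^sub>R g \<in> nbhd pr" using e t by (auto simp: dist_norm subset_eq)
  have "cost pr x + t * (norm g)\<^sup>2 \<le> cost pr (x + t *\<^sub>R g)"
    using st x y unfolding standing_def subdifferential_def g_def
    by (force simp: power2_norm_eq_inner)
  moreover have "\<bar>cost pr (x + t *\<^sub>R g) - cost pr x\<bar> \<le> Lf * (t * norm g)"
    using lipschitz_on_normD[of Lf "nbhd pr" "cost pr" "x + t *\<^sub>R g" x] st y \<open>x \<in> nbhd pr\<close> t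
    unfolding standing_def by auto
  ultimately have "t * (norm g)\<^sup>2 \<le> t * (Lf * norm g)" by (simp add: algebra_simps)
  then have "norm g * norm g \<le> Lf * norm g" using t by (simp add: power2_eq_square)
  then show ?thesis using Lf_nonneg by (cases "g = 0") (auto simp: g_def)
qed

lemma norm_direction_le: "x \<in> X \<Longrightarrow> norm (Z x i) \<le> Lf + LQ"
  unfolding direction_def using st norm_subgrad_le[of x]
  by (intro order_trans[OF norm_triangle_ineq4] add_mono) (auto simp: standing_def)

lemma direction_subgradient:
  assumes "x \<in> X" "y \<in> X"
  shows "cost pr x + Q i x + Z x i \<bullet> (y - x) \<le> cost pr y + Q i y"
  using cost_subgradient[OF assms] recourse_subgradient[OF assms, of i]
  by (simp add: direction_def inner_diff_left)

lemma gibbs_softmax: "p x = softmax (\<lambda>i. Q i x / w)"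
  by (auto simp: gibbs_def softmax_def)

lemma gibbs_pos: "0 < p x i" and sum_gibbs: "(\<Sum>i\<in>UNIV. p x i) = 1"
  by (simp_all add: gibbs_softmax softmax_pos sum_softmax)

lemma abs_gibbs_average_le: "(\<And>i. \<bar>u i\<bar> \<le> B) \<Longrightarrow> \<bar>\<Sum>i\<in>UNIV. p x i * u i\<bar> \<le> B"
  unfolding gibbs_softmax by (rule abs_softmax_average_le)

lemma gibbs_lipschitz:
  assumes "x \<in> X" "y \<in> X"
  shows "(\<Sum>i\<in>UNIV. \<bar>p x i - p y i\<bar>) \<le> 2 * LQ / w * norm (x - y)"
proof -
  have "(\<Sum>i\<in>UNIV. \<bar>p x i - p y i\<bar>) \<le> 2 * (LQ * norm (x - y) / w)"
    unfolding gibbs_softmax using w Q_lipschitz[OF assms]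
    by (intro softmax_lipschitz) (auto simp: diff_divide_distrib[symmetric] abs_divide divide_right_mono)
  then show ?thesis by (simp add: field_simps)
qed

text \<open>Only log-sum-exp is linearised; the differences of costs and recourse values stay exact.
  This is what allows the noise to be expressed through function values in
  \<open>direction_lower_bound\<close>.\<close>

lemma surrogate_tangent:
  "F x + (cost pr y - cost pr x) + (\<Sum>i\<in>UNIV. p x i * (Q i y - Q i x)) \<le> F y"
proof -
  define s where "s u i = Q i u / w" for u i
  have ln: "ln (1 / real CARD('i) * (\<Sum>i\<in>UNIV. exp (s u i))) = ln (\<Sum>i\<in>UNIV. exp (s u i)) - ln (real CARD('i))" for u
    using sum_exp_pos[of "s u"] by (simp add: ln_div)
  have "w * (ln (\<Sum>j\<in>UNIV. exp (s x j)) + (\<Sum>j\<in>UNIV. p x j * (s y j - s x j))) \<le> w * ln (\<Sum>j\<in>UNIV. exp (s y j))"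
    using w log_sum_exp_tangent[of "s x" "s y"] unfolding gibbs_softmax s_def[symmetric]
    by (intro mult_left_mono) auto
  moreover have "w * (\<Sum>j\<in>UNIV. p x j * (s y j - s x j)) = (\<Sum>i\<in>UNIV. p x i * (Q i y - Q i x))"
    unfolding sum_distrib_left s_def using w by (intro sum.cong) (auto simp: field_simps)
  ultimately show ?thesis
    unfolding surrogate_def s_def[symmetric] ln by (simp add: algebra_simps)
qed

definition mean_direction :: "real^'x \<Rightarrow> real^'x" where
  "mean_direction x = (\<Sum>i\<in>UNIV. p x i *\<^sub>R Z x i)"

text \<open>Source of the Lipschitz constant of the surrogate and of Jensen's inequality for
  it.\<close>

lemma surrogate_subgradient:
  assumes "x \<in> X" "y \<in> X"
  shows "F x + mean_direction x \<bullet> (y - x) \<le> F y"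
proof -
  have "mean_direction x \<bullet> (y - x) = (\<Sum>i\<in>UNIV. p x i * (Z x i \<bullet> (y - x)))"
    by (simp add: mean_direction_def inner_sum_left)
  also have "\<dots> \<le> (\<Sum>i\<in>UNIV. p x i * ((cost pr y - cost pr x) + (Q i y - Q i x)))"
    using direction_subgradient[OF assms] gibbs_pos[of x]
    by (intro sum_mono mult_left_mono) (auto simp: less_imp_le algebra_simps)
  also have "\<dots> = (cost pr y - cost pr x) + (\<Sum>i\<in>UNIV. p x i * (Q i y - Q i x))"
    by (simp add: distrib_left sum.distrib sum_gibbs flip: sum_distrib_right)
  finally show ?thesis using surrogate_tangent[of x y] by linarith
qed

lemma norm_mean_direction_le:
  assumes "x \<in> X"
  shows "norm (mean_direction x) \<le> Lf + LQ"
proof -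
  have "norm (mean_direction x) \<le> (\<Sum>i\<in>UNIV. p x i * (Lf + LQ))"
    unfolding mean_direction_def using gibbs_pos[of x] norm_direction_le[OF assms]
    by (intro order_trans[OF norm_sum] sum_mono) (auto simp: less_imp_le abs_of_pos intro!: mult_left_mono)
  then show ?thesis by (simp add: sum_gibbs flip: sum_distrib_right)
qed

lemma surrogate_diff_le:
  assumes "x \<in> X" "y \<in> X"
  shows "F x - F y \<le> (Lf + LQ) * norm (x - y)"
proof -
  have "\<bar>mean_direction x \<bullet> (y - x)\<bar> \<le> norm (mean_direction x) * norm (y - x)"
    by (rule Cauchy_Schwarz_ineq2)
  also have "\<dots> \<le> (Lf + LQ) * norm (x - y)"
    using norm_mean_direction_le[OF assms(1)] by (simp add: norm_minus_commute mult_right_mono)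
  finally show ?thesis using surrogate_subgradient[OF assms] by linarith
qed

lemma surrogate_lipschitz: "(Lf + LQ)-lipschitz_on X F"
proof (rule lipschitz_onI)
  fix x y assume "x \<in> X" "y \<in> X"
  then show "dist (F x) (F y) \<le> (Lf + LQ) * dist x y"
    using surrogate_diff_le[of x y] surrogate_diff_le[of y x]
    by (simp add: dist_norm abs_le_iff norm_minus_commute)
qed (use LQ_nonneg Lf_nonneg in simp)

text \<open>The subgradient inequality at the average point, summed with the weights: the linear
  terms cancel.\<close>

lemma surrogate_jensen:
  assumes "finite S" "\<And>k. k \<in> S \<Longrightarrow> 0 \<le> c k" "(\<Sum>k\<in>S. c k) = 1" "\<And>k. k \<in> S \<Longrightarrow> u k \<in> X"
  shows "(\<Sum>k\<in>S. c k *\<^sub>R u k) \<in> X" "F (\<Sum>k\<in>S. c k *\<^sub>R u k) \<le> (\<Sum>k\<in>S. c k * F (u k))"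
proof -
  define a where "a = (\<Sum>k\<in>S. c k *\<^sub>R u k)"
  have "convex X" using st by (simp add: standing_def)
  then have a: "a \<in> X" unfolding a_def using assms by (intro convex_sum) auto
  then show "(\<Sum>k\<in>S. c k *\<^sub>R u k) \<in> X" by (simp add: a_def)
  have "(\<Sum>k\<in>S. c k * (F a + mean_direction a \<bullet> (u k - a))) \<le> (\<Sum>k\<in>S. c k * F (u k))"
    using assms a by (intro sum_mono mult_left_mono surrogate_subgradient) auto
  moreover have "(\<Sum>k\<in>S. c k * (F a + mean_direction a \<bullet> (u k - a)))
     = (\<Sum>k\<in>S. c k) * F a + mean_direction a \<bullet> ((\<Sum>k\<in>S. c k *\<^sub>R u k) - (\<Sum>k\<in>S. c k) *\<^sub>R a)"
    by (simp add: distrib_left sum.distrib sum_distrib_right inner_diff_right inner_sum_right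
        sum_subtractf scaleR_sum_left algebra_simps)
  ultimately show "F (\<Sum>k\<in>S. c k *\<^sub>R u k) \<le> (\<Sum>k\<in>S. c k * F (u k))"
    using assms by (simp add: a_def)
qed


section \<open>The transition kernel\<close>

lemma proposal_pos: "0 < proposal pr j i" and sum_proposal: "(\<Sum>j\<in>UNIV. proposal pr j i) = 1"
  using st unfolding standing_def by auto

lemma acc_prob_eq: "acc_prob pr w x i j = acceptance_fun (accept pr) (ratio pr w x i j)"
  by (simp add: acc_prob_def acceptance_fun_def)

lemma ratio_pos: "0 < ratio pr w x i j"
  by (simp add: ratio_def gibbs_pos proposal_pos)

lemma ratio_eq: "ratio pr w x i j = proposal pr i j / proposal pr j i * exp ((Q j x - Q i x) / w)"
proof -
  have "p x j / p x i = exp ((Q j x - Q i x) / w)"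
    using sum_exp_pos[of "\<lambda>i. Q i x / w"] by (simp add: gibbs_def diff_divide_distrib exp_diff)
  then show ?thesis by (simp add: ratio_def mult.commute flip: times_divide_times_eq)
qed

lemma kernel_offdiag: "i \<noteq> j \<Longrightarrow> K x $ i $ j = proposal pr j i * acc_prob pr w x i j"
  and kernel_diag: "K x $ i $ i = 1 - (\<Sum>k\<in>UNIV - {i}. proposal pr k i * acc_prob pr w x i k)"
  by (auto simp: kernel_def)

lemma kernel_offdiag_pos: "i \<noteq> j \<Longrightarrow> 0 < K x $ i $ j"
  by (simp add: kernel_offdiag proposal_pos acc_prob_eq acceptance_fun_pos ratio_pos)

lemma kernel_nonneg: "0 \<le> K x $ i $ j"
proof (cases "i = j")
  case True
  have "(\<Sum>k\<in>UNIV - {i}. proposal pr k i * acc_prob pr w x i k) \<le> (\<Sum>k\<in>UNIV - {i}. proposal pr k i * 1)"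
    using proposal_pos by (intro sum_mono mult_left_mono) (auto simp: acc_prob_eq acceptance_fun_le_1 ratio_pos less_imp_le)
  also have "\<dots> \<le> (\<Sum>k\<in>UNIV. proposal pr k i)"
    using proposal_pos by (simp, intro sum_mono2) (auto simp: less_imp_le)
  finally show ?thesis using True by (simp add: kernel_diag sum_proposal)
qed (simp add: kernel_offdiag_pos less_imp_le)

lemma sum_kernel: "(\<Sum>j\<in>UNIV. K x $ i $ j) = 1"
  by (subst sum.remove[of _ i]) (auto simp: kernel_diag kernel_offdiag intro!: sum.cong)

lemma kernel_balance: "p x i * K x $ i $ j = p x j * K x $ j $ i"
proof (cases "i = j")
  case False
  then show ?thesis
    unfolding kernel_offdiag[OF False] kernel_offdiag[OF False[symmetric]] acc_prob_eq ratio_def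
    by (intro acceptance_fun_swap gibbs_pos proposal_pos)
qed simp

lemma kernel_stationary: "(\<Sum>i\<in>UNIV. p x i * K x $ i $ j) = p x j"
  by (simp add: kernel_balance[of x _ j] sum_kernel flip: sum_distrib_left)

lemma kernel_average: "(\<Sum>i\<in>UNIV. p x i * (K x *v v) $ i) = (\<Sum>i\<in>UNIV. p x i * v $ i)"
proof -
  have "(\<Sum>i\<in>UNIV. p x i * (K x *v v) $ i) = (\<Sum>j\<in>UNIV. (\<Sum>i\<in>UNIV. p x i * K x $ i $ j) * v $ j)"
    unfolding matrix_vector_mult_def by (simp add: sum_distrib_left sum_distrib_right mult.assoc) (rule sum.swap)
  then show ?thesis by (simp add: kernel_stationary)
qed

lemma abs_kernel_vec_le:
  assumes "\<And>j. \<bar>v $ j\<bar> \<le> B"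
  shows "\<bar>(K x *v v) $ i\<bar> \<le> B"
proof -
  have "\<bar>(K x *v v) $ i\<bar> \<le> (\<Sum>j\<in>UNIV. K x $ i $ j * B)"
    unfolding matrix_vector_mult_def using assms kernel_nonneg[of x i]
    by (auto simp: abs_mult intro!: order_trans[OF sum_abs] sum_mono mult_left_mono)
  then show ?thesis by (simp add: sum_kernel flip: sum_distrib_right)
qed

text \<open>Maximum principle: at an index \<open>i\<close> where \<open>v\<close> is largest,
  \<open>v $ i\<close> is an average of all entries with positive off-diagonal weights, so no entry
  can be smaller.\<close>

lemma kernel_fixed_const:
  assumes v: "K x *v v = v"
  shows "v $ j = v $ k"
proof -
  define i where "i = arg_max_on (($) v) UNIV"
  have max: "v $ l \<le> v $ i" for l
  proof -
    have "finite (range (($) v))" by simp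
    then have "Max (range (($) v)) \<in> range (($) v)" by (intro Max_in) auto
    then obtain i0 where "v $ i0 = Max (range (($) v))" by (metis rangeE)
    then have "is_arg_max (($) v) (\<lambda>l. l \<in> UNIV) i0"
      by (auto simp: is_arg_max_linorder)
    then have "is_arg_max (($) v) (\<lambda>l. l \<in> UNIV) i"
      unfolding i_def arg_max_on_def arg_max_def by (rule someI)
    then show ?thesis by (auto simp: is_arg_max_linorder)
  qed
  have "(\<Sum>l\<in>UNIV. K x $ i $ l * (v $ i - v $ l)) = v $ i - (K x *v v) $ i"
    by (simp add: right_diff_distrib sum_subtractf sum_kernel matrix_vector_mult_def flip: sum_distrib_right)
  then have "(\<Sum>l\<in>UNIV. K x $ i $ l * (v $ i - v $ l)) = 0" using v by simp
  then have zero: "K x $ i $ l * (v $ i - v $ l) = 0" for l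
    using max kernel_nonneg by (subst (asm) sum_nonneg_eq_0_iff) auto
  then have "v $ l = v $ i" for l
    using kernel_offdiag_pos[of i l x] zero[of l] by (cases "l = i") auto
  then show ?thesis by metis
qed

text \<open>The proposal factor in the ratio does not depend on the point, so the logarithm of the
  ratio moves by at most \<open>d\<close>, and so does each acceptance probability. The off-diagonal
  part of a row contributes \<open>d\<close> at most and the diagonal entry, a complement, the same
  again; this doubles the 2 in \<open>d\<close> to 4.\<close>

lemma kernel_lipschitz_explicit: "kernel_lipschitz pr w (4 * LQ / w)"
  unfolding kernel_lipschitz_def
proof (intro conjI allI ballI)
  show "0 \<le> 4 * LQ / w" using LQ_nonneg w by simp
  fix i x y assume xy: "x \<in> X" "y \<in> X"
  define d where "d = 2 * LQ / w * norm (x - y)"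
  define \<Delta> where "\<Delta> k = acc_prob pr w x i k - acc_prob pr w y i k" for k
  have \<Delta>: "\<bar>\<Delta> k\<bar> \<le> d" for k
  proof -
    have "\<bar>\<Delta> k\<bar> \<le> \<bar>(Q k x - Q i x) / w - (Q k y - Q i y) / w\<bar>"
      unfolding \<Delta>_def acc_prob_eq ratio_eq by (intro acceptance_fun_lipschitz divide_pos_pos proposal_pos)
    also have "\<dots> = \<bar>(Q k x - Q k y) - (Q i x - Q i y)\<bar> / w"
    proof -
      have "(Q k x - Q i x) / w - (Q k y - Q i y) / w = ((Q k x - Q k y) - (Q i x - Q i y)) / w"
        by (simp add: diff_divide_distrib)
      then show ?thesis using w by (simp add: abs_divide)
    qed
    also have "\<dots> \<le> (2 * LQ * norm (x - y)) / w"
      using Q_lipschitz[OF xy, of k] Q_lipschitz[OF xy, of i] w by (intro divide_right_mono) linarith+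
    finally show ?thesis by (simp add: d_def)
  qed
  have d: "0 \<le> d" using \<Delta>[of i] by linarith
  define R where "R = (\<Sum>k\<in>UNIV - {i}. proposal pr k i * \<bar>\<Delta> k\<bar>)"
  have "R \<le> (\<Sum>k\<in>UNIV - {i}. proposal pr k i * d)"
    unfolding R_def using \<Delta> proposal_pos by (intro sum_mono mult_left_mono) (auto simp: less_imp_le)
  also have "\<dots> \<le> (\<Sum>k\<in>UNIV. proposal pr k i * d)"
    using proposal_pos d by (intro sum_mono2) (auto simp: less_imp_le)
  finally have R: "R \<le> d" by (simp add: sum_proposal flip: sum_distrib_right)
  have "\<bar>K x $ i $ i - K y $ i $ i\<bar> = \<bar>\<Sum>k\<in>UNIV - {i}. proposal pr k i * \<Delta> k\<bar>"
    by (simp add: kernel_diag \<Delta>_def right_diff_distrib sum_subtractf abs_minus_commute)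
  also have "\<dots> \<le> R"
    unfolding R_def using proposal_pos by (intro order_trans[OF sum_abs]) (auto simp: abs_mult abs_of_pos)
  finally have diag: "\<bar>K x $ i $ i - K y $ i $ i\<bar> \<le> R" .
  have "(\<Sum>j\<in>UNIV - {i}. \<bar>K x $ i $ j - K y $ i $ j\<bar>) = R"
    unfolding R_def \<Delta>_def
    by (intro sum.cong) (auto simp: kernel_offdiag abs_mult abs_of_pos proposal_pos simp flip: right_diff_distrib)
  then have "(\<Sum>j\<in>UNIV. \<bar>K x $ i $ j - K y $ i $ j\<bar>) \<le> R + R"
    using diag by (simp add: sum.remove[of UNIV i])
  also have "\<dots> \<le> 4 * LQ / w * norm (x - y)" using R by (simp add: d_def)
  finally show "(\<Sum>j\<in>UNIV. \<bar>K x $ i $ j - K y $ i $ j\<bar>) \<le> 4 * LQ / w * norm (x - y)" .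
qed

section \<open>Invertibility of the matrix in the Poisson equation\<close>

definition poisson_matrix :: "real^'x \<Rightarrow> real^'i^'i" where
  "poisson_matrix x = mat 1 - K x + (\<chi> i j. p x j)"

lemma poisson_matrix_vec:
  "(poisson_matrix x *v v) $ i = v $ i - (K x *v v) $ i + (\<Sum>j\<in>UNIV. p x j * v $ j)"
proof -
  have "poisson_matrix x *v v = v - K x *v v + (\<chi> i j. p x j) *v v"
    by (simp add: poisson_matrix_def matrix_vector_mult_add_rdistrib matrix_vector_mult_diff_rdistrib)
  then show ?thesis by (simp add: matrix_vector_mult_def)
qed

lemma poisson_matrix_average:
  "(\<Sum>i\<in>UNIV. p x i * (poisson_matrix x *v v) $ i) = (\<Sum>i\<in>UNIV. p x i * v $ i)"
  unfolding poisson_matrix_vec distrib_left right_diff_distrib sum.distrib sum_subtractf kernel_average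
  by (simp add: sum_gibbs flip: sum_distrib_right)

text \<open>Averaging with the stationary weights removes \<open>v - K x *v v\<close>, so
  \<open>v\<close> has mean zero. Then \<open>v\<close> is fixed by the kernel, hence constant, and
  a constant of mean zero vanishes.\<close>

lemma poisson_matrix_ker:
  assumes "poisson_matrix x *v v = 0"
  shows "v = 0"
proof -
  have avg: "(\<Sum>i\<in>UNIV. p x i * v $ i) = 0"
    using poisson_matrix_average[of x v] assms by simp
  then have "K x *v v = v"
    using assms poisson_matrix_vec[of x v] by (simp add: vec_eq_iff)
  then have const: "v $ i = v $ j" for i j by (rule kernel_fixed_const)
  have "v $ j = 0" for j
  proof -
    have "(\<Sum>i\<in>UNIV. p x i * v $ i) = (\<Sum>i\<in>UNIV. p x i) * v $ j"
      unfolding sum_distrib_right by (intro sum.cong arg_cong2[of _ _ _ _ "(*)"] const) auto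
    with avg show ?thesis by (simp add: sum_gibbs)
  qed
  then show ?thesis by (simp add: vec_eq_iff)
qed

lemma fundamental_matrix_eq: "fundamental_matrix pr w x = matrix_inv (poisson_matrix x)"
  by (simp add: fundamental_matrix_def poisson_matrix_def)

lemma fundamental_matrix_inverse:
  "poisson_matrix x *v (fundamental_matrix pr w x *v v) = v"
  "fundamental_matrix pr w x *v (poisson_matrix x *v v) = v"
  unfolding fundamental_matrix_eq by (rule matrix_inv_inverse; erule poisson_matrix_ker)+

lemma fundamental_matrix_average:
  "(\<Sum>i\<in>UNIV. p x i * (fundamental_matrix pr w x *v v) $ i) = (\<Sum>i\<in>UNIV. p x i * v $ i)"
  using poisson_matrix_average[of x "fundamental_matrix pr w x *v v"]
  by (simp only: fundamental_matrix_inverse)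

text \<open>Constant vectors are fixed by the Poisson matrix and so by its inverse. The bound gives
  \<open>C \<le> C\<^sup>2\<close>, which the rates use to merge powers of \<open>C\<close>.\<close>

lemma fundamental_matrix_bound_ge_1:
  assumes "opnorm infnorm (fundamental_matrix pr w x) \<le> C"
  shows "1 \<le> C"
proof -
  define e :: "real^'i" where "e = (\<chi> i. 1)"
  have "poisson_matrix x *v e = e"
    unfolding vec_eq_iff poisson_matrix_vec by (simp add: e_def matrix_vector_mult_def sum_kernel sum_gibbs)
  then have "fundamental_matrix pr w x *v e = e"
    using fundamental_matrix_inverse(2)[of x e] by simp
  moreover have "\<bar>(fundamental_matrix pr w x *v e) $ undefined\<bar> \<le> C * 1"
    by (rule opnorm_infnorm_component[OF assms]) (simp add: e_def)
  ultimately show ?thesis by (simp add: e_def)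
qed

end

section \<open>The Poisson equation\<close>

text \<open>The direction \<^term>\<open>direction pr x i\<close> is discontinuous in \<open>x\<close>, but by convexity its inner product with
  \<open>x - xs\<close> dominates a difference of function values. So the Poisson equation is solved for the
  scalar \<^term>\<open>recourse pr x (scen pr i) - recourse pr xs (scen pr i)\<close>, which is Lipschitz in \<open>x\<close>.\<close>

locale soft_separation_mixing = soft_separation pr w D Lf LQ
  for pr :: "('x::finite, 'z::finite, 'y::finite, 'm::finite, 'i::finite) problem"
    and w D Lf LQ :: real +
  fixes C LP :: real and xs :: "real^'x"
  assumes fundamental: "\<And>x. x \<in> X \<Longrightarrow> opnorm infnorm (fundamental_matrix pr w x) \<le> C"
    and lip: "kernel_lipschitz pr w LP" and xs: "xs \<in> X"
begin

definition excess :: "real^'x \<Rightarrow> real^'i" where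
  "excess x = (\<chi> i. Q i x - Q i xs)"

definition noise :: "real^'x \<Rightarrow> real^'i" where
  "noise x = (\<chi> i. excess x $ i - (\<Sum>j\<in>UNIV. p x j * excess x $ j))"

definition poisson :: "real^'x \<Rightarrow> real^'i" where
  "poisson x = fundamental_matrix pr w x *v noise x"

definition predicted :: "real^'x \<Rightarrow> real^'i" where
  "predicted x = K x *v poisson x"

abbreviation "BZ \<equiv> B_Z C D LQ"
abbreviation "LZ \<equiv> L_Z C D LQ LP w"
abbreviation "Lm \<equiv> LP * BZ + LZ"

lemma C_ge_1: "1 \<le> C"
  using fundamental_matrix_bound_ge_1 fundamental xs by blast

lemma LP_nonneg: "0 \<le> LP"
  and kernel_diff: "x \<in> X \<Longrightarrow> y \<in> X \<Longrightarrow> (\<Sum>j\<in>UNIV. \<bar>K x $ i $ j - K y $ i $ j\<bar>) \<le> LP * norm (x - y)"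
  using lip by (auto simp: kernel_lipschitz_def)

lemma BZ_nonneg: "0 \<le> BZ"
  using C_ge_1 D_nonneg[OF xs] LQ_nonneg by (simp add: B_Z_def)

lemma Lm_nonneg: "0 \<le> Lm"
  using C_ge_1 D_nonneg[OF xs] LQ_nonneg LP_nonneg BZ_nonneg w by (simp add: L_Z_def)

lemma abs_excess_le: "x \<in> X \<Longrightarrow> \<bar>excess x $ i\<bar> \<le> LQ * D"
  using Q_lipschitz[OF _ xs, of x i] mult_left_mono[OF norm_diff_le_D[OF _ xs] LQ_nonneg, of x]
  by (auto simp: excess_def)

lemma abs_noise_le:
  assumes "x \<in> X"
  shows "\<bar>noise x $ i\<bar> \<le> 2 * D * LQ"
proof -
  have "\<bar>\<Sum>j\<in>UNIV. p x j * excess x $ j\<bar> \<le> LQ * D"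
    by (rule abs_gibbs_average_le[OF abs_excess_le[OF assms]])
  moreover have "2 * D * LQ = LQ * D + LQ * D" by simp
  ultimately show ?thesis
    using abs_excess_le[OF assms, of i] unfolding noise_def vec_lambda_beta by linarith
qed

text \<open>The entry of \<open>excess\<close> and its average each move by \<open>LQ\<close> times
  the distance. The term with \<open>D\<close> is the change of the weights, at rate
  \<open>2 * LQ / w\<close>, against an excess of size at most \<open>LQ * D\<close>.\<close>

lemma noise_diff:
  assumes x: "x \<in> X" and y: "y \<in> X"
  shows "\<bar>noise x $ i - noise y $ i\<bar> \<le> (2 * LQ + 2 * D * LQ\<^sup>2 / w) * norm (x - y)"
proof -
  have ex: "\<bar>excess x $ j - excess y $ j\<bar> \<le> LQ * norm (x - y)" for j
    using Q_lipschitz[OF x y] by (simp add: excess_def)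
  have "\<bar>\<Sum>j\<in>UNIV. p x j * (excess x $ j - excess y $ j)\<bar> \<le> LQ * norm (x - y)"
    by (rule abs_gibbs_average_le[OF ex])
  moreover have "\<bar>\<Sum>j\<in>UNIV. (p x j - p y j) * excess y $ j\<bar> \<le> 2 * D * LQ\<^sup>2 / w * norm (x - y)"
  proof -
    have "\<bar>\<Sum>j\<in>UNIV. (p x j - p y j) * excess y $ j\<bar> \<le> (\<Sum>j\<in>UNIV. \<bar>p x j - p y j\<bar> * (LQ * D))"
      using abs_excess_le[OF y] by (auto simp: abs_mult intro!: order_trans[OF sum_abs] sum_mono mult_left_mono)
    also have "\<dots> \<le> 2 * LQ / w * norm (x - y) * (LQ * D)"
      unfolding sum_distrib_right[symmetric] using gibbs_lipschitz[OF x y] LQ_nonneg D_nonneg[OF x]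
      by (intro mult_right_mono) auto
    finally show ?thesis by (simp add: power2_eq_square algebra_simps)
  qed
  moreover have "noise x $ i - noise y $ i = (excess x $ i - excess y $ i)
      - (\<Sum>j\<in>UNIV. p x j * (excess x $ j - excess y $ j)) - (\<Sum>j\<in>UNIV. (p x j - p y j) * excess y $ j)"
    by (simp add: noise_def algebra_simps sum_subtractf)
  moreover have "(2 * LQ + 2 * D * LQ\<^sup>2 / w) * norm (x - y)
      = LQ * norm (x - y) + LQ * norm (x - y) + 2 * D * LQ\<^sup>2 / w * norm (x - y)"
    by (simp add: algebra_simps)
  ultimately show ?thesis using ex[of i] by linarith
qed

text \<open>The noise is centred under the stationary law and the fundamental matrix preserves that
  average, so the rank-one term of the Poisson matrix drops out.\<close>

lemma poisson_equation: "poisson x $ i - predicted x $ i = noise x $ i"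
proof -
  have "(\<Sum>i\<in>UNIV. p x i * noise x $ i) = 0"
    by (simp add: noise_def right_diff_distrib sum_subtractf sum_gibbs flip: sum_distrib_right)
  then have "(\<Sum>i\<in>UNIV. p x i * poisson x $ i) = 0"
    unfolding poisson_def fundamental_matrix_average .
  moreover have "(poisson_matrix x *v poisson x) $ i = noise x $ i"
    unfolding poisson_def fundamental_matrix_inverse ..
  ultimately show ?thesis by (simp only: poisson_matrix_vec predicted_def)
qed

lemma abs_poisson_le: "x \<in> X \<Longrightarrow> \<bar>poisson x $ i\<bar> \<le> BZ"
  unfolding poisson_def
  using opnorm_infnorm_component[OF fundamental abs_noise_le] by (simp add: B_Z_def algebra_simps)

lemma abs_predicted_le: "x \<in> X \<Longrightarrow> \<bar>predicted x $ i\<bar> \<le> BZ"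
  unfolding predicted_def by (rule abs_kernel_vec_le[OF abs_poisson_le])

lemma abs_kernel_diff_vec_le:
  assumes x: "x \<in> X" and y: "y \<in> X" and v: "\<And>j. \<bar>v $ j\<bar> \<le> B"
  shows "\<bar>(K x *v v) $ i - (K y *v v) $ i\<bar> \<le> LP * norm (x - y) * B"
proof -
  have "0 \<le> B" using v[of undefined] by linarith
  have "(K x *v v) $ i - (K y *v v) $ i = (\<Sum>j\<in>UNIV. (K x $ i $ j - K y $ i $ j) * v $ j)"
    by (simp add: matrix_vector_mult_def left_diff_distrib sum_subtractf)
  also have "\<bar>\<dots>\<bar> \<le> (\<Sum>j\<in>UNIV. \<bar>K x $ i $ j - K y $ i $ j\<bar> * B)"
    using v by (auto simp: abs_mult intro!: order_trans[OF sum_abs] sum_mono mult_left_mono)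
  also have "\<dots> \<le> LP * norm (x - y) * B"
    unfolding sum_distrib_right[symmetric] using \<open>0 \<le> B\<close> kernel_diff[OF x y] by (intro mult_right_mono)
  finally show ?thesis .
qed

lemma abs_poisson_matrix_diff_le:
  assumes x: "x \<in> X" and y: "y \<in> X" and v: "\<And>j. \<bar>v $ j\<bar> \<le> B"
  shows "\<bar>(poisson_matrix y *v v - poisson_matrix x *v v) $ i\<bar> \<le> (LP + 2 * LQ / w) * norm (x - y) * B"
proof -
  have "0 \<le> B" using v[of undefined] by linarith
  have "\<bar>\<Sum>j\<in>UNIV. (p y j - p x j) * v $ j\<bar> \<le> (\<Sum>j\<in>UNIV. \<bar>p x j - p y j\<bar> * B)"
    using v by (auto simp: abs_mult abs_minus_commute intro!: order_trans[OF sum_abs] sum_mono mult_mono)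
  also have "\<dots> \<le> 2 * LQ / w * norm (x - y) * B"
    unfolding sum_distrib_right[symmetric] using \<open>0 \<le> B\<close> gibbs_lipschitz[OF x y] by (intro mult_right_mono)
  finally have "\<bar>\<Sum>j\<in>UNIV. (p y j - p x j) * v $ j\<bar> \<le> 2 * LQ / w * norm (x - y) * B" .
  moreover have "(poisson_matrix y *v v - poisson_matrix x *v v) $ i
      = ((K x *v v) $ i - (K y *v v) $ i) + (\<Sum>j\<in>UNIV. (p y j - p x j) * v $ j)"
    by (simp add: poisson_matrix_vec left_diff_distrib sum_subtractf del: vector_minus_component)
      (simp add: poisson_matrix_vec)
  ultimately show ?thesis
    using abs_kernel_diff_vec_le[OF x y v, of i] unfolding distrib_right by linarith
qed

text \<open>Resolvent identity: with \<open>A\<close> the Poisson matrix, the difference is the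
  inverse of \<open>A x\<close> applied to the change of the noise plus \<open>(A y - A x)\<close>
  applied to \<open>poisson y\<close>. The second term meets the bound on the inverse twice, once
  openly and once inside \<open>BZ\<close>, which gives the part of \<open>L_Z\<close> with
  \<open>C\<^sup>2\<close>.\<close>

lemma poisson_diff:
  assumes x: "x \<in> X" and y: "y \<in> X"
  shows "\<bar>poisson x $ i - poisson y $ i\<bar> \<le> LZ * norm (x - y)"
proof -
  define a where "a = fundamental_matrix pr w x *v (noise x - noise y)"
  define b where "b = fundamental_matrix pr w x *v (poisson_matrix y *v poisson y - poisson_matrix x *v poisson y)"
  have "poisson_matrix y *v poisson y = noise y"
    unfolding poisson_def by (rule fundamental_matrix_inverse)
  then have "poisson x - poisson y = a + b"
    unfolding a_def b_def matrix_vector_mult_diff_distrib fundamental_matrix_inverse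
    by (simp add: poisson_def)
  moreover have "\<bar>a $ i\<bar> \<le> C * ((2 * LQ + 2 * D * LQ\<^sup>2 / w) * norm (x - y))"
    unfolding a_def by (rule opnorm_infnorm_component[OF fundamental[OF x]]) (use noise_diff[OF x y] in simp)
  moreover have "\<bar>b $ i\<bar> \<le> C * ((LP + 2 * LQ / w) * norm (x - y) * BZ)"
    unfolding b_def
    by (intro opnorm_infnorm_component[OF fundamental[OF x]] abs_poisson_matrix_diff_le x y abs_poisson_le)
  ultimately have "\<bar>(poisson x - poisson y) $ i\<bar> \<le>
      C * ((2 * LQ + 2 * D * LQ\<^sup>2 / w) * norm (x - y)) + C * ((LP + 2 * LQ / w) * norm (x - y) * BZ)"
    by simp
  also have "\<dots> = LZ * norm (x - y)"
    by (simp add: L_Z_def B_Z_def power2_eq_square algebra_simps)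
  finally show ?thesis by simp
qed

text \<open>First the kernel is changed with the vector held fixed (\<open>LP * BZ\<close>), then
  the vector under a kernel that averages (\<open>LZ\<close>).\<close>

lemma predicted_diff:
  assumes x: "x \<in> X" and y: "y \<in> X"
  shows "\<bar>predicted x $ i - predicted y $ i\<bar> \<le> Lm * norm (x - y)"
proof -
  have "\<bar>(K x *v poisson x) $ i - (K y *v poisson x) $ i\<bar> \<le> LP * norm (x - y) * BZ"
    by (intro abs_kernel_diff_vec_le x y abs_poisson_le)
  moreover have "\<bar>(K y *v (poisson x - poisson y)) $ i\<bar> \<le> LZ * norm (x - y)"
    by (rule abs_kernel_vec_le) (use poisson_diff[OF x y] in simp)
  ultimately show ?thesis
    by (simp add: predicted_def matrix_vector_mult_diff_distrib algebra_simps)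
qed

text \<open>Convexity is used twice: the surrogate gap is at most the cost gap plus the mean excess,
  and the inner product is at least the cost gap plus the excess of the drawn index. What separates
  the two excess terms is the noise, that is, the Poisson difference.\<close>

lemma direction_lower_bound:
  assumes x: "x \<in> X"
  shows "F x - F xs + (poisson x $ i - predicted x $ i) \<le> Z x i \<bullet> (x - xs)"
proof -
  have "F x - F xs \<le> (cost pr x - cost pr xs) + (\<Sum>j\<in>UNIV. p x j * excess x $ j)"
    using surrogate_tangent[of x xs] by (simp add: excess_def right_diff_distrib sum_subtractf)
  moreover have "cost pr x - cost pr xs + excess x $ i \<le> Z x i \<bullet> (x - xs)"
    using direction_subgradient[OF x xs, of i] by (simp add: excess_def inner_diff_right)
  ultimately show ?thesis
    by (simp add: poisson_equation noise_def)
qed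

end

section \<open>The stochastic process\<close>

locale soft_separation_run = soft_separation_mixing pr w D Lf LQ C LP xs
  for pr :: "('x::finite, 'z::finite, 'y::finite, 'm::finite, 'i::finite) problem"
    and w D Lf LQ C LP :: real and xs +
  fixes \<alpha> :: "nat \<Rightarrow> real" and M :: "'w measure" and \<F> and x :: "nat \<Rightarrow> 'w \<Rightarrow> real^'x" and I :: "nat \<Rightarrow> 'w \<Rightarrow> 'i"
  assumes run: "method_run pr w \<alpha> M \<F> x I"
    and \<alpha>_pos: "\<And>k. 1 \<le> k \<Longrightarrow> 0 < \<alpha> k"
    and xs_min: "\<And>u. u \<in> X \<Longrightarrow> F xs \<le> F u"
begin

sublocale prob_space M
  using run by (simp add: method_run_def)

lemma subalg: "subalgebra M (\<F> n)"
  and subalg_Suc: "subalgebra (\<F> (Suc n)) (\<F> n)"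
proof -
  show sub: "subalgebra M (\<F> n)" for n using run by (simp add: method_run_def)
  have "filtration (space M) \<F>" using run by (simp add: method_run_def)
  then have "sets (\<F> n) \<subseteq> sets (\<F> (Suc n))" by (simp add: filtration_def)
  then show "subalgebra (\<F> (Suc n)) (\<F> n)" using sub unfolding subalgebra_def by simp
qed

lemma space_filt: "space (\<F> n) = space M"
  using subalg unfolding subalgebra_def by blast

lemma index_measurable: "I n \<in> measurable (\<F> n) (count_space UNIV)"
  using run by (simp add: method_run_def)

lemma closed_feas: "closed X" and convex_feas: "convex X" and feas_nonempty: "X \<noteq> {}"
  using st xs by (auto simp: standing_def compact_imp_closed)

lemma iterate_Suc:
  "\<omega> \<in> space M \<Longrightarrow> x (Suc n) \<omega> = closest_point X (x n \<omega> - \<alpha> (Suc n) *\<^sub>R Z (x n \<omega>) (I (Suc n) \<omega>))"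
  using run by (simp add: method_run_def)

lemma iterate_feas: "\<omega> \<in> space M \<Longrightarrow> x n \<omega> \<in> X"
proof (induction n)
  case 0
  then show ?case using run by (simp add: method_run_def)
next
  case (Suc n)
  then show ?case by (simp add: iterate_Suc closest_point_in_set closed_feas feas_nonempty)
qed

lemma direction_measurable: "(\<lambda>u. Z u i) \<in> borel_measurable (restrict_space borel X)"
proof -
  have [measurable]: "subgrad pr \<in> borel_measurable (restrict_space borel X)"
    "(\<lambda>u. dualsel pr u i) \<in> borel_measurable (restrict_space borel X)"
    using st by (auto simp: standing_def)
  have [measurable]: "(\<lambda>v. transpose (Emat pr) *v v) \<in> borel_measurable borel"
    by (intro borel_measurable_continuous_onI matrix_vector_mult_linear_continuous_on)
  show ?thesis unfolding direction_def by measurable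
qed

text \<open>The direction is measurable in the point only on \<open>X\<close>, so \<open>x n\<close>
  is viewed as a map into the restricted space; the random index is resolved by its finitely many
  values.\<close>

lemma iterate_measurable: "x n \<in> borel_measurable (\<F> n)"
proof (induction n)
  case 0
  then show ?case using run by (simp add: method_run_def)
next
  case (Suc n)
  have x [measurable]: "x n \<in> borel_measurable (\<F> (Suc n))"
    by (rule measurable_from_subalg[OF subalg_Suc Suc])
  then have "x n \<in> measurable (\<F> (Suc n)) (restrict_space borel X)"
    using iterate_feas by (intro measurable_restrict_space2) (auto simp: space_filt)
  then have "(\<lambda>\<omega>. Z (x n \<omega>) i) \<in> borel_measurable (\<F> (Suc n))" for i
    by (rule measurable_compose[OF _ direction_measurable])
  then have [measurable]: "(\<lambda>\<omega>. Z (x n \<omega>) (I (Suc n) \<omega>)) \<in> borel_measurable (\<F> (Suc n))"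
    by (rule measurable_compose_countable'[OF _ index_measurable]) auto
  have [measurable]: "closest_point X \<in> borel_measurable borel"
    by (intro borel_measurable_continuous_onI continuous_on_closest_point convex_feas closed_feas feas_nonempty)
  have "(\<lambda>\<omega>. closest_point X (x n \<omega> - \<alpha> (Suc n) *\<^sub>R Z (x n \<omega>) (I (Suc n) \<omega>))) \<in> borel_measurable (\<F> (Suc n))"
    by measurable
  then show ?case
    by (subst measurable_cong[OF iterate_Suc]) (auto simp: space_filt)
qed

lemma iterate_function_measurable:
  fixes g :: "real^'x \<Rightarrow> real"
  assumes "continuous_on X g"
  shows "(\<lambda>\<omega>. g (x n \<omega>)) \<in> borel_measurable (\<F> n)"
proof -
  have "x n \<in> measurable (\<F> n) (restrict_space borel X)"
    using iterate_feas iterate_measurable by (intro measurable_restrict_space2) (auto simp: space_filt)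
  then show ?thesis
    by (rule measurable_compose[OF _ borel_measurable_continuous_on_restrict[OF assms]])
qed

lemma iterate_index_function_measurable:
  fixes g :: "real^'x \<Rightarrow> 'i \<Rightarrow> real"
  assumes "\<And>i. continuous_on X (\<lambda>u. g u i)"
  shows "(\<lambda>\<omega>. g (x n \<omega>) (I n \<omega>)) \<in> borel_measurable (\<F> n)"
    and "(\<lambda>\<omega>. g (x n \<omega>) (I (Suc n) \<omega>)) \<in> borel_measurable (\<F> (Suc n))"
proof -
  have g: "(\<lambda>\<omega>. g (x n \<omega>) i) \<in> borel_measurable (\<F> n)" for i
    by (rule iterate_function_measurable[OF assms])
  show "(\<lambda>\<omega>. g (x n \<omega>) (I n \<omega>)) \<in> borel_measurable (\<F> n)"
    by (rule measurable_compose_countable'[OF g index_measurable]) auto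
  show "(\<lambda>\<omega>. g (x n \<omega>) (I (Suc n) \<omega>)) \<in> borel_measurable (\<F> (Suc n))"
    by (rule measurable_compose_countable'[OF measurable_from_subalg[OF subalg_Suc g] index_measurable]) auto
qed

lemma integrable_bounded:
  fixes g :: "'w \<Rightarrow> real"
  assumes "g \<in> borel_measurable (\<F> n)" "\<And>\<omega>. \<omega> \<in> space M \<Longrightarrow> \<bar>g \<omega>\<bar> \<le> B"
  shows "integrable M g"
  using assms by (intro integrable_const_bound[of _ B] measurable_from_subalg[OF subalg]) auto

lemma continuous_on_F: "continuous_on X F"
  by (rule lipschitz_on_continuous_on[OF surrogate_lipschitz])

lemma continuous_on_poisson: "continuous_on X (\<lambda>u. poisson u $ i)"
proof -
  have "\<bar>LZ\<bar>-lipschitz_on X (\<lambda>u. poisson u $ i)"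
  proof (rule lipschitz_onI)
    fix u v assume "u \<in> X" "v \<in> X"
    then have "\<bar>poisson u $ i - poisson v $ i\<bar> \<le> LZ * norm (u - v)" by (rule poisson_diff)
    also have "\<dots> \<le> \<bar>LZ\<bar> * norm (u - v)" by (intro mult_right_mono) auto
    finally show "dist (poisson u $ i) (poisson v $ i) \<le> \<bar>LZ\<bar> * dist u v"
      by (simp add: dist_norm)
  qed simp
  then show ?thesis by (rule lipschitz_on_continuous_on)
qed

lemma continuous_on_predicted: "continuous_on X (\<lambda>u. predicted u $ i)"
  using predicted_diff Lm_nonneg
  by (intro lipschitz_on_continuous_on[of Lm] lipschitz_onI) (auto simp: dist_norm)

lemma continuous_on_kernel: "continuous_on X (\<lambda>u. K u $ i $ j)"
proof -
  have "LP-lipschitz_on X (\<lambda>u. K u $ i $ j)"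
  proof (rule lipschitz_onI)
    fix u v assume uv: "u \<in> X" "v \<in> X"
    have "\<bar>K u $ i $ j - K v $ i $ j\<bar> \<le> (\<Sum>j\<in>UNIV. \<bar>K u $ i $ j - K v $ i $ j\<bar>)"
      by (rule member_le_sum) auto
    with kernel_diff[OF uv, of i] show "dist (K u $ i $ j) (K v $ i $ j) \<le> LP * dist u v"
      by (simp add: dist_norm)
  qed (rule LP_nonneg)
  then show ?thesis by (rule lipschitz_on_continuous_on)
qed

lemma abs_F_le: "u \<in> X \<Longrightarrow> \<bar>F u\<bar> \<le> \<bar>F xs\<bar> + (Lf + LQ) * D"
  using surrogate_diff_le[OF _ xs, of u] surrogate_diff_le[OF xs, of u] LQ_nonneg Lf_nonneg
    mult_left_mono[OF norm_diff_le_D[OF _ xs], of u "Lf + LQ"]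
  by (simp add: norm_minus_commute)

lemma integrable_F: "integrable M (\<lambda>\<omega>. F (x n \<omega>))"
  by (rule integrable_bounded[OF iterate_function_measurable[OF continuous_on_F] abs_F_le[OF iterate_feas]])

lemma square_dist_le: "u \<in> X \<Longrightarrow> (norm (u - xs))\<^sup>2 \<le> D\<^sup>2"
  using norm_diff_le_D[OF _ xs, of u] by (intro power_mono) auto

lemma integrable_dist: "integrable M (\<lambda>\<omega>. (norm (x n \<omega> - xs))\<^sup>2)"
proof (rule integrable_bounded[where B = "D\<^sup>2" and n = n])
  show "(\<lambda>\<omega>. (norm (x n \<omega> - xs))\<^sup>2) \<in> borel_measurable (\<F> n)"
    by (intro iterate_function_measurable continuous_intros)
qed (use square_dist_le iterate_feas in auto)

lemma integrable_predicted: "integrable M (\<lambda>\<omega>. predicted (x n \<omega>) $ I n \<omega>)"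
  by (rule integrable_bounded[OF iterate_index_function_measurable(1)[OF continuous_on_predicted]])
    (rule abs_predicted_le[OF iterate_feas])

lemma integrable_poisson: "integrable M (\<lambda>\<omega>. poisson (x n \<omega>) $ I (Suc n) \<omega>)"
  by (rule integrable_bounded[OF iterate_index_function_measurable(2)[OF continuous_on_poisson]])
    (rule abs_poisson_le[OF iterate_feas])

text \<open>Here the conditional law of the draw enters. After a split by the value \<open>j\<close>
  of the next index, the factor \<open>poisson (x n \<omega>) $ j\<close> is known at time
  \<open>n\<close>, so the indicator may be replaced by its conditional expectation, a kernel
  entry.\<close>

lemma expectation_poisson:
  "expectation (\<lambda>\<omega>. poisson (x n \<omega>) $ I (Suc n) \<omega>) = expectation (\<lambda>\<omega>. predicted (x n \<omega>) $ I n \<omega>)"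
proof -
  interpret fs: finite_measure_subalgebra M "\<F> n"
    by unfold_locales (rule subalg)
  define A where "A j = {\<omega>\<in>space M. I (Suc n) \<omega> = j}" for j
  have A: "A j \<in> sets M" for j
    unfolding A_def using measurable_from_subalg[OF subalg index_measurable[of "Suc n"]] by measurable
  have cond: "AE \<omega> in M. real_cond_exp M (\<F> n) (indicator (A j)) \<omega> = K (x n \<omega>) $ I n \<omega> $ j" for j
    using run by (simp add: method_run_def A_def)
  have pm: "(\<lambda>\<omega>. poisson (x n \<omega>) $ j) \<in> borel_measurable (\<F> n)" for j
    by (rule iterate_function_measurable[OF continuous_on_poisson])
  have pi: "integrable M (\<lambda>\<omega>. poisson (x n \<omega>) $ j)" for j
    by (rule integrable_bounded[OF pm abs_poisson_le[OF iterate_feas]])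
  have int1: "integrable M (\<lambda>\<omega>. poisson (x n \<omega>) $ j * indicator (A j) \<omega>)" for j
    using A pi by (rule integrable_real_mult_indicator)
  have int2: "integrable M (\<lambda>\<omega>. poisson (x n \<omega>) $ j * K (x n \<omega>) $ I n \<omega> $ j)" for j
  proof (rule integrable_bounded)
    show "(\<lambda>\<omega>. poisson (x n \<omega>) $ j * K (x n \<omega>) $ I n \<omega> $ j) \<in> borel_measurable (\<F> n)"
      by (rule iterate_index_function_measurable(1)[where g = "\<lambda>u i. poisson u $ j * K u $ i $ j"])
        (intro continuous_intros continuous_on_poisson continuous_on_kernel)
    fix \<omega> assume "\<omega> \<in> space M"
    have "K (x n \<omega>) $ I n \<omega> $ j \<le> (\<Sum>j\<in>UNIV. K (x n \<omega>) $ I n \<omega> $ j)"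
      by (rule member_le_sum) (auto simp: kernel_nonneg)
    then have "\<bar>K (x n \<omega>) $ I n \<omega> $ j\<bar> \<le> 1" using kernel_nonneg by (simp add: sum_kernel)
    then show "\<bar>poisson (x n \<omega>) $ j * K (x n \<omega>) $ I n \<omega> $ j\<bar> \<le> BZ * 1"
      unfolding abs_mult using abs_poisson_le[OF iterate_feas[OF \<open>\<omega> \<in> space M\<close>]] BZ_nonneg
      by (intro mult_mono) auto
  qed
  have "expectation (\<lambda>\<omega>. poisson (x n \<omega>) $ I (Suc n) \<omega>)
      = expectation (\<lambda>\<omega>. \<Sum>j\<in>UNIV. poisson (x n \<omega>) $ j * indicator (A j) \<omega>)"
    by (intro Bochner_Integration.integral_cong) (auto simp: A_def indicator_def if_distrib[of "(*) _"] cong: if_cong)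
  also have "\<dots> = (\<Sum>j\<in>UNIV. expectation (\<lambda>\<omega>. poisson (x n \<omega>) $ j * indicator (A j) \<omega>))"
    by (rule Bochner_Integration.integral_sum[OF int1])
  also have "\<dots> = (\<Sum>j\<in>UNIV. expectation (\<lambda>\<omega>. poisson (x n \<omega>) $ j * real_cond_exp M (\<F> n) (indicator (A j)) \<omega>))"
    using A by (intro sum.cong fs.real_cond_exp_intg(2)[symmetric] int1 pm) auto
  also have "\<dots> = (\<Sum>j\<in>UNIV. expectation (\<lambda>\<omega>. poisson (x n \<omega>) $ j * K (x n \<omega>) $ I n \<omega> $ j))"
  proof (intro sum.cong refl integral_cong_AE)
    fix j
    show "(\<lambda>\<omega>. poisson (x n \<omega>) $ j * real_cond_exp M (\<F> n) (indicator (A j)) \<omega>) \<in> borel_measurable M"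
      using measurable_from_subalg[OF subalg pm] by measurable
    show "(\<lambda>\<omega>. poisson (x n \<omega>) $ j * K (x n \<omega>) $ I n \<omega> $ j) \<in> borel_measurable M"
      using int2 by auto
    show "AE \<omega> in M. poisson (x n \<omega>) $ j * real_cond_exp M (\<F> n) (indicator (A j)) \<omega>
        = poisson (x n \<omega>) $ j * K (x n \<omega>) $ I n \<omega> $ j"
      using cond[of j] by eventually_elim simp
  qed
  also have "\<dots> = expectation (\<lambda>\<omega>. \<Sum>j\<in>UNIV. poisson (x n \<omega>) $ j * K (x n \<omega>) $ I n \<omega> $ j)"
    by (rule Bochner_Integration.integral_sum[OF int2, symmetric])
  also have "\<dots> = expectation (\<lambda>\<omega>. predicted (x n \<omega>) $ I n \<omega>)"
    by (simp add: predicted_def matrix_vector_mult_def mult.commute)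
  finally show ?thesis .
qed

text \<open>Equals \<open>C_1 C D Lf LQ LP w + 3 * (Lf + LQ)\<^sup>2\<close>, the coefficient of the
  squared step sizes.\<close>

definition "H = 2 * (Lf + LQ) * Lm + 3 * (Lf + LQ)\<^sup>2"

text \<open>The Poisson solution is taken at the old point and the prediction at the new one, both
  at the index just drawn: their means are then \<open>bias n\<close> and
  \<open>bias (Suc n)\<close>, which telescope.\<close>

lemma iterate_step:
  assumes \<omega>: "\<omega> \<in> space M"
  shows "2 * \<alpha> (Suc n) * (F (x (Suc n) \<omega>) - F xs) \<le>
    (norm (x n \<omega> - xs))\<^sup>2 - (norm (x (Suc n) \<omega> - xs))\<^sup>2
    - 2 * \<alpha> (Suc n) * (poisson (x n \<omega>) $ I (Suc n) \<omega> - predicted (x (Suc n) \<omega>) $ I (Suc n) \<omega>)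
    + H * (\<alpha> (Suc n))\<^sup>2"
proof -
  define a where "a = \<alpha> (Suc n)"
  define u where "u = x n \<omega>"
  define v where "v = x (Suc n) \<omega>"
  define i where "i = I (Suc n) \<omega>"
  define G where "G = Lf + LQ"
  have a: "0 < a" using \<alpha>_pos by (simp add: a_def)
  have G: "0 \<le> G" using LQ_nonneg Lf_nonneg by (simp add: G_def)
  have u: "u \<in> X" and v: "v \<in> X" using iterate_feas[OF \<omega>] by (auto simp: u_def v_def)
  have v_eq: "v = closest_point X (u - a *\<^sub>R Z u i)"
    using iterate_Suc[OF \<omega>] by (simp add: a_def u_def v_def i_def)
  \<comment> \<open>A point of \<open>X\<close> is its own projection. With \<open>t = xs\<close>
    this gives the distance recursion, with \<open>t = u\<close> the length of the move.\<close>
  have nonexp: "norm (v - t) \<le> norm (u - a *\<^sub>R Z u i - t)" if "t \<in> X" for t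
    using closest_point_lipschitz[OF convex_feas closed_feas feas_nonempty, of "u - a *\<^sub>R Z u i" t] that
    by (simp add: v_eq dist_norm closest_point_self)
  have ZG: "norm (Z u i) \<le> G" unfolding G_def by (rule norm_direction_le[OF u])
  have move: "norm (v - u) \<le> a * G"
    using nonexp[OF u] a ZG by (simp add: mult_left_mono order_trans)
  have "(norm (v - xs))\<^sup>2 \<le> (norm ((u - xs) - a *\<^sub>R Z u i))\<^sup>2"
    using nonexp[OF xs] by (intro power_mono) (auto simp: algebra_simps)
  also have "\<dots> = (norm (u - xs))\<^sup>2 - 2 * a * (Z u i \<bullet> (u - xs)) + a\<^sup>2 * (norm (Z u i))\<^sup>2"
    unfolding power2_norm_eq_inner by (simp add: inner_diff inner_commute power2_eq_square algebra_simps)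
  also have "\<dots> \<le> (norm (u - xs))\<^sup>2 - 2 * a * (Z u i \<bullet> (u - xs)) + a\<^sup>2 * G\<^sup>2"
    using ZG by (intro add_left_mono mult_left_mono power_mono) auto
  finally have dist: "2 * a * (Z u i \<bullet> (u - xs)) \<le> (norm (u - xs))\<^sup>2 - (norm (v - xs))\<^sup>2 + a\<^sup>2 * G\<^sup>2"
    by simp
  have "F v - F u \<le> G * (a * G)"
    using surrogate_diff_le[OF v u] mult_left_mono[OF move G] by (simp add: G_def)
  \<comment> \<open>The price \<open>Lm * (a * G)\<close> of moving the prediction to the new point,
    once multiplied by \<open>2 * a\<close>, is the \<open>C_1\<close> part of
    \<open>H\<close>.\<close>
  moreover have "predicted u $ i - predicted v $ i \<le> Lm * (a * G)"
    using predicted_diff[OF u v, of i] mult_left_mono[OF move Lm_nonneg]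
    by (simp add: norm_minus_commute)
  ultimately have "F v - F xs \<le> Z u i \<bullet> (u - xs) - (poisson u $ i - predicted v $ i) + (G * (a * G) + Lm * (a * G))"
    using direction_lower_bound[OF u, of i] by linarith
  then have "2 * a * (F v - F xs) \<le>
      2 * a * (Z u i \<bullet> (u - xs) - (poisson u $ i - predicted v $ i) + (G * (a * G) + Lm * (a * G)))"
    using a by (intro mult_left_mono) auto
  also have "\<dots> = 2 * a * (Z u i \<bullet> (u - xs)) - 2 * a * (poisson u $ i - predicted v $ i)
      + (2 * G * Lm + 2 * G\<^sup>2) * a\<^sup>2"
    by (simp add: power2_eq_square algebra_simps)
  also have "\<dots> \<le> (norm (u - xs))\<^sup>2 - (norm (v - xs))\<^sup>2 - 2 * a * (poisson u $ i - predicted v $ i)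
      + (2 * G * Lm + 3 * G\<^sup>2) * a\<^sup>2"
    using dist by (simp add: algebra_simps)
  finally show ?thesis by (simp add: a_def u_def v_def i_def G_def H_def)
qed

definition gap :: "nat \<Rightarrow> real" where
  "gap n = expectation (\<lambda>\<omega>. F (x n \<omega>)) - F xs"

definition sqdist :: "nat \<Rightarrow> real" where
  "sqdist n = expectation (\<lambda>\<omega>. (norm (x n \<omega> - xs))\<^sup>2)"

definition bias :: "nat \<Rightarrow> real" where
  "bias n = expectation (\<lambda>\<omega>. predicted (x n \<omega>) $ I n \<omega>)"

lemma expectation_between:
  assumes "integrable M g" "\<And>\<omega>. \<omega> \<in> space M \<Longrightarrow> a \<le> g \<omega>" "\<And>\<omega>. \<omega> \<in> space M \<Longrightarrow> g \<omega> \<le> b"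
  shows "a \<le> expectation g \<and> expectation g \<le> (b :: real)"
  using integral_mono[of M "\<lambda>_. a" g] integral_mono[of M g "\<lambda>_. b"] assms by (auto simp: prob_space)

lemma sqdist_bounds: "0 \<le> sqdist n \<and> sqdist n \<le> D\<^sup>2"
  unfolding sqdist_def
  by (rule expectation_between[OF integrable_dist]) (simp_all add: square_dist_le iterate_feas)

lemma bias_bounds: "- BZ \<le> bias n \<and> bias n \<le> BZ"
  unfolding bias_def
proof (rule expectation_between[OF integrable_predicted])
  fix \<omega> assume "\<omega> \<in> space M"
  from abs_predicted_le[OF iterate_feas[OF this], of n "I n \<omega>"]
  show "- BZ \<le> predicted (x n \<omega>) $ I n \<omega>" "predicted (x n \<omega>) $ I n \<omega> \<le> BZ" by linarith+
qed

lemma gap_step: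
  "2 * \<alpha> (Suc n) * gap (Suc n) \<le> sqdist n - sqdist (Suc n)
     - 2 * \<alpha> (Suc n) * (bias n - bias (Suc n)) + H * (\<alpha> (Suc n))\<^sup>2"
proof -
  note int = integrable_F integrable_dist integrable_poisson integrable_predicted
  have "expectation (\<lambda>\<omega>. 2 * \<alpha> (Suc n) * (F (x (Suc n) \<omega>) - F xs)) \<le>
    expectation (\<lambda>\<omega>. (norm (x n \<omega> - xs))\<^sup>2 - (norm (x (Suc n) \<omega> - xs))\<^sup>2
    - 2 * \<alpha> (Suc n) * (poisson (x n \<omega>) $ I (Suc n) \<omega> - predicted (x (Suc n) \<omega>) $ I (Suc n) \<omega>)
    + H * (\<alpha> (Suc n))\<^sup>2)"
    by (intro integral_mono iterate_step Bochner_Integration.integrable_add Bochner_Integration.integrable_diff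
        integrable_mult_right int integrable_const)
  then show ?thesis
    by (simp add: int gap_def sqdist_def bias_def expectation_poisson prob_space)
qed

lemma weighted_average_eq:
  "weighted_average c u n = (\<Sum>k=1..n. (c k / (\<Sum>k=1..n. c k)) *\<^sub>R u k)" for u :: "nat \<Rightarrow> real^'x"
  by (simp add: weighted_average_def scaleR_sum_right divide_inverse mult.commute)

text \<open>Averages stay in the convex set, so the lower bound is minimality of \<open>xs\<close>
  and the upper one is Jensen's inequality for each outcome, before the expectation. Monotonicity of
  the integral requires that the surrogate of the average be integrable.\<close>

lemma expected_gap_bounds:
  assumes c: "\<And>k. 1 \<le> k \<Longrightarrow> 0 < c k" and n: "1 \<le> n"
  shows "0 \<le> expected_gap pr w M c x n"
    and "(\<Sum>k=1..n. c k) * expected_gap pr w M c x n \<le> (\<Sum>k=1..n. c k * gap k)"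
proof -
  define S where "S = (\<Sum>k=1..n. c k)"
  have S: "0 < S" unfolding S_def using c n by (intro sum_pos) auto
  define b where "b k = c k / S" for k
  have b: "(\<Sum>k=1..n. b k) = 1" using S by (simp add: b_def S_def flip: sum_divide_distrib)
  have b0: "0 \<le> b k" if "k \<in> {1..n}" for k
    using c[of k] that S by (auto simp: b_def less_imp_le)
  define avg where "avg \<omega> = weighted_average c (\<lambda>k. x k \<omega>) n" for \<omega>
  have avg: "avg \<omega> = (\<Sum>k=1..n. b k *\<^sub>R x k \<omega>)" for \<omega>
    unfolding avg_def b_def S_def by (rule weighted_average_eq)
  have avg_feas: "avg \<omega> \<in> X" and jensen: "F (avg \<omega>) \<le> (\<Sum>k=1..n. b k * F (x k \<omega>))" if "\<omega> \<in> space M" for \<omega>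
    unfolding avg using that b b0 iterate_feas by (auto intro!: surrogate_jensen)
  have [measurable]: "x k \<in> borel_measurable M" for k
    by (rule measurable_from_subalg[OF subalg iterate_measurable])
  have "avg \<in> borel_measurable M" unfolding avg by measurable
  then have "avg \<in> measurable M (restrict_space borel X)"
    using avg_feas by (intro measurable_restrict_space2) auto
  then have "(\<lambda>\<omega>. F (avg \<omega>)) \<in> borel_measurable M"
    by (rule measurable_compose[OF _ borel_measurable_continuous_on_restrict[OF continuous_on_F]])
  then have int: "integrable M (\<lambda>\<omega>. F (avg \<omega>))"
    using abs_F_le[OF avg_feas] by (intro integrable_const_bound[where B = "\<bar>F xs\<bar> + (Lf + LQ) * D"]) auto
  have "(INF z\<in>X. F z) = F xs"
    using xs xs_min by (intro cInf_eq_minimum) auto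
  then have eq: "expected_gap pr w M c x n = expectation (\<lambda>\<omega>. F (avg \<omega>)) - F xs"
    by (simp add: expected_gap_def avg_def)
  have "expectation (\<lambda>_. F xs) \<le> expectation (\<lambda>\<omega>. F (avg \<omega>))"
    using int xs_min avg_feas by (intro integral_mono) auto
  then show "0 \<le> expected_gap pr w M c x n"
    by (simp add: eq prob_space)
  have "expectation (\<lambda>\<omega>. F (avg \<omega>)) \<le> expectation (\<lambda>\<omega>. \<Sum>k=1..n. b k * F (x k \<omega>))"
    using int integrable_F jensen by (intro integral_mono) auto
  also have "\<dots> = (\<Sum>k=1..n. b k * (gap k + F xs))"
    using integrable_F by (simp add: gap_def)
  also have "\<dots> = (\<Sum>k=1..n. b k * gap k) + F xs"
    using b by (simp add: distrib_left sum.distrib flip: sum_distrib_right)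
  finally have "expected_gap pr w M c x n \<le> (\<Sum>k=1..n. b k * gap k)" by (simp add: eq)
  then have "S * expected_gap pr w M c x n \<le> S * (\<Sum>k=1..n. b k * gap k)"
    using S by (intro mult_left_mono) auto
  also have "\<dots> = (\<Sum>k=1..n. c k * gap k)"
    unfolding sum_distrib_left b_def using S by (intro sum.cong) auto
  finally show "(\<Sum>k=1..n. c k) * expected_gap pr w M c x n \<le> (\<Sum>k=1..n. c k * gap k)"
    by (simp add: S_def)
qed

end

section \<open>Summation by parts and rates\<close>

lemma abel_sum_nonincreasing:
  fixes b e :: "nat \<Rightarrow> real"
  assumes b: "\<And>k. 1 \<le> k \<Longrightarrow> b (Suc k) \<le> b k" "\<And>k. 1 \<le> k \<Longrightarrow> 0 \<le> b k"
    and e: "\<And>k. 0 \<le> e k \<and> e k \<le> \<Delta>" and n: "1 \<le> n"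
  shows "(\<Sum>k=1..n. b k * (e (k - 1) - e k)) \<le> b 1 * \<Delta>"
proof -
  \<comment> \<open>The boundary term \<open>- b n * e n\<close> of summation by parts is kept so
    that the induction closes; it is nonpositive and dropped at the end.\<close>
  have "(\<Sum>k=1..n. b k * (e (k - 1) - e k)) \<le> b 1 * \<Delta> - b n * e n"
    using n
  proof (induction n rule: nat_induct_at_least)
    case base
    show ?case using mult_left_mono[of "e 0" \<Delta> "b 1"] b(2)[of 1] e by (simp add: algebra_simps)
  next
    case (Suc n)
    have "b (Suc n) * e n \<le> b n * e n" using b(1) Suc.hyps e by (intro mult_right_mono) auto
    then show ?case using Suc.IH by (simp add: algebra_simps)
  qed
  moreover have "0 \<le> b n * e n" using b(2)[OF n] e by simp
  ultimately show ?thesis by linarith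
qed

lemma abel_sum_nondecreasing:
  fixes b e :: "nat \<Rightarrow> real"
  assumes b: "\<And>k. 1 \<le> k \<Longrightarrow> b k \<le> b (Suc k)" "\<And>k. 1 \<le> k \<Longrightarrow> 0 \<le> b k"
    and e: "\<And>k. 0 \<le> e k \<and> e k \<le> \<Delta>" and n: "1 \<le> n"
  shows "(\<Sum>k=1..n. b k * (e (k - 1) - e k)) \<le> b n * \<Delta>"
proof -
  \<comment> \<open>For growing weights the induction works with the nonnegative sequence
    \<open>\<Delta> - e n\<close>, because it is this factor that the larger weight may
    multiply.\<close>
  have "(\<Sum>k=1..n. b k * (e (k - 1) - e k)) \<le> b n * (\<Delta> - e n)"
    using n
  proof (induction n rule: nat_induct_at_least)
    case base
    show ?case using mult_left_mono[of "e 0" \<Delta> "b 1"] b(2)[of 1] e by (simp add: algebra_simps)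
  next
    case (Suc n)
    have "b n * (\<Delta> - e n) \<le> b (Suc n) * (\<Delta> - e n)" using b(1) Suc.hyps e by (intro mult_right_mono) auto
    then show ?case using Suc.IH by (simp add: algebra_simps)
  qed
  moreover have "b n * (\<Delta> - e n) \<le> b n * \<Delta>" using b(2)[OF n] e by (intro mult_left_mono) auto
  ultimately show ?thesis by linarith
qed

lemma sum_inverse_Suc_le_ln: "(\<Sum>k=1..n. 1 / (real k + 1)) \<le> ln (real n + 1)"
proof (induction n)
  case (Suc n)
  have "ln ((real n + 1) / (real n + 2)) \<le> (real n + 1) / (real n + 2) - 1"
    by (intro ln_le_minus_one) auto
  also have "\<dots> = - 1 / (real n + 2)" by (simp add: field_simps)
  finally have "1 / (real n + 2) \<le> ln (real n + 2) - ln (real n + 1)" by (simp add: ln_div)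
  with Suc show ?case by (simp add: algebra_simps)
qed simp

section \<open>Bounds for both averages under nonincreasing step sizes\<close>

context soft_separation_run
begin

text \<open>The one-step bound multiplied by \<open>u k / \<alpha> k\<close>, which frees the
  weights from the step sizes. Reflecting the bias to \<open>BZ - bias k\<close> gives its
  differences the right sign and puts it between 0 and \<open>2 * BZ\<close>, as summation by parts
  expects.\<close>

lemma weighted_gap_le:
  assumes u: "\<And>k. 1 \<le> k \<Longrightarrow> 0 < u k"
  shows "2 * (\<Sum>k=1..n. u k * gap k) \<le> (\<Sum>k=1..n. u k / \<alpha> k * (sqdist (k - 1) - sqdist k))
    + 2 * (\<Sum>k=1..n. u k * ((BZ - bias (k - 1)) - (BZ - bias k))) + H * (\<Sum>k=1..n. u k * \<alpha> k)"
proof -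
  have "2 * (u k * gap k) \<le> u k / \<alpha> k * (sqdist (k - 1) - sqdist k)
      + 2 * (u k * ((BZ - bias (k - 1)) - (BZ - bias k))) + H * (u k * \<alpha> k)" if "1 \<le> k" for k
  proof -
    have a: "0 < \<alpha> k" "0 < u k" using \<alpha>_pos u that by auto
    have "2 * \<alpha> k * gap k \<le> sqdist (k - 1) - sqdist k - 2 * \<alpha> k * (bias (k - 1) - bias k) + H * (\<alpha> k)\<^sup>2"
      using gap_step[of "k - 1"] that by simp
    then have "u k / \<alpha> k * (2 * \<alpha> k * gap k) \<le> u k / \<alpha> k *
        (sqdist (k - 1) - sqdist k - 2 * \<alpha> k * (bias (k - 1) - bias k) + H * (\<alpha> k)\<^sup>2)"
      using a by (intro mult_left_mono) auto
    moreover have "u k / \<alpha> k * (2 * \<alpha> k * gap k) = 2 * (u k * gap k)"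
      using a by simp
    moreover have "u k / \<alpha> k * (S - 2 * \<alpha> k * (bias (k - 1) - bias k) + H * (\<alpha> k)\<^sup>2)
      = u k / \<alpha> k * S + 2 * (u k * ((BZ - bias (k - 1)) - (BZ - bias k))) + H * (u k * \<alpha> k)" for S
      using a by (simp add: field_simps power2_eq_square)
    ultimately show ?thesis by simp
  qed
  then have "(\<Sum>k=1..n. 2 * (u k * gap k)) \<le> (\<Sum>k=1..n. u k / \<alpha> k * (sqdist (k - 1) - sqdist k)
      + 2 * (u k * ((BZ - bias (k - 1)) - (BZ - bias k))) + H * (u k * \<alpha> k))"
    by (intro sum_mono) auto
  then show ?thesis unfolding sum.distrib sum_distrib_left[symmetric] .
qed

lemma bias_shift_bounds: "0 \<le> BZ - bias k \<and> BZ - bias k \<le> 2 * BZ"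
  using bias_bounds[of k] by linarith

text \<open>For \<open>u = \<alpha>\<close> the squared distances carry weight 1 and telescope, and
  the bias is summed against nonincreasing weights.\<close>

lemma step_average_gap_le:
  assumes mono: "\<And>k. 1 \<le> k \<Longrightarrow> \<alpha> (Suc k) \<le> \<alpha> k" and n: "1 \<le> n"
  shows "2 * (\<Sum>k=1..n. \<alpha> k) * expected_gap pr w M \<alpha> x n
    \<le> sqdist 0 + C_0 C D LQ (\<alpha> 1) + H * (\<Sum>k=1..n. (\<alpha> k)\<^sup>2)"
proof -
  have "(\<Sum>k=1..n. \<alpha> k / \<alpha> k * (sqdist (k - 1) - sqdist k)) = (\<Sum>k=1..n. sqdist (k - 1) - sqdist k)"
    using \<alpha>_pos by (intro sum.cong) (auto simp: less_imp_neq[symmetric])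
  also have "\<dots> = sqdist 0 - sqdist n"
    by (induction n) auto
  also have "\<dots> \<le> sqdist 0" using sqdist_bounds by simp
  finally have "(\<Sum>k=1..n. \<alpha> k / \<alpha> k * (sqdist (k - 1) - sqdist k)) \<le> sqdist 0" .
  moreover have "(\<Sum>k=1..n. \<alpha> k * ((BZ - bias (k - 1)) - (BZ - bias k))) \<le> \<alpha> 1 * (2 * BZ)"
    using \<alpha>_pos n by (intro abel_sum_nonincreasing[of _ "\<lambda>k. BZ - bias k"] mono bias_shift_bounds) (auto simp: less_imp_le)
  moreover have "2 * (\<Sum>k=1..n. \<alpha> k * gap k) \<le> (\<Sum>k=1..n. \<alpha> k / \<alpha> k * (sqdist (k - 1) - sqdist k))
      + 2 * (\<Sum>k=1..n. \<alpha> k * ((BZ - bias (k - 1)) - (BZ - bias k))) + H * (\<Sum>k=1..n. \<alpha> k * \<alpha> k)"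
    by (rule weighted_gap_le) (rule \<alpha>_pos)
  moreover have "C_0 C D LQ (\<alpha> 1) = 2 * (\<alpha> 1 * (2 * BZ))" by (simp add: C_0_def)
  ultimately have "2 * (\<Sum>k=1..n. \<alpha> k * gap k) \<le> sqdist 0 + C_0 C D LQ (\<alpha> 1) + H * (\<Sum>k=1..n. (\<alpha> k)\<^sup>2)"
    unfolding power2_eq_square by linarith
  then show ?thesis using expected_gap_bounds(2)[of \<alpha> n] \<alpha>_pos n by simp
qed

text \<open>For \<open>u k = k\<close> both weights, \<open>k / \<alpha> k\<close> and
  \<open>k\<close>, are nondecreasing, so each sum is charged at its last weight. The left factor is
  twice the sum of the weights.\<close>

lemma linear_average_gap_le:
  assumes mono: "\<And>k. 1 \<le> k \<Longrightarrow> \<alpha> (Suc k) \<le> \<alpha> k" and n: "1 \<le> n"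
  shows "real n * (real n + 1) * expected_gap pr w M real x n
    \<le> real n / \<alpha> n * D\<^sup>2 + 4 * real n * BZ + H * (\<Sum>k=1..n. real k * \<alpha> k)"
proof -
  have "(\<Sum>k=1..n. real k / \<alpha> k * (sqdist (k - 1) - sqdist k)) \<le> real n / \<alpha> n * D\<^sup>2"
  proof (rule abel_sum_nondecreasing[OF _ _ _ n])
    show "real k / \<alpha> k \<le> real (Suc k) / \<alpha> (Suc k)" "0 \<le> real k / \<alpha> k" if "1 \<le> k" for k
      using mono[OF that] \<alpha>_pos[OF that] \<alpha>_pos[of "Suc k"] by (auto intro!: frac_le)
  qed (rule sqdist_bounds)
  moreover have "(\<Sum>k=1..n. real k * ((BZ - bias (k - 1)) - (BZ - bias k))) \<le> real n * (2 * BZ)"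
    using n by (intro abel_sum_nondecreasing[of _ "\<lambda>k. BZ - bias k"] bias_shift_bounds) auto
  ultimately have "2 * (\<Sum>k=1..n. real k * gap k)
      \<le> real n / \<alpha> n * D\<^sup>2 + 4 * real n * BZ + H * (\<Sum>k=1..n. real k * \<alpha> k)"
    using weighted_gap_le[of real n] by linarith
  moreover have "(\<Sum>k=1..n. real k) * expected_gap pr w M real x n \<le> (\<Sum>k=1..n. real k * gap k)"
    using n by (intro expected_gap_bounds) auto
  moreover have "real n * (real n + 1) * expected_gap pr w M real x n
      = 2 * ((\<Sum>k=1..n. real k) * expected_gap pr w M real x n)"
  proof -
    have "real n * (real n + 1) = 2 * (\<Sum>k=1..n. real k)"
      by (induction n) (auto simp: algebra_simps)
    then show ?thesis by (simp only: mult.assoc)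
  qed
  ultimately show ?thesis by linarith
qed

end

section \<open>Rates for step sizes proportional to 1 / sqrt (k + 1)\<close>

locale soft_separation_rate = soft_separation_run pr w D Lf LQ C "4 * LQ / w" xs \<alpha> M \<F> x I
  for pr :: "('x::finite, 'z::finite, 'y::finite, 'm::finite, 'i::finite) problem"
    and w D Lf LQ C :: real and xs \<alpha> and M :: "'w measure" and \<F> x I +
  fixes c :: real
  assumes c: "0 < c" and \<alpha>_eq: "\<And>k. 1 \<le> k \<Longrightarrow> \<alpha> k = c / sqrt (real k + 1)"
begin

definition "H_const = 2 * (Lf + LQ) * (2 * LQ + 22 * D * LQ\<^sup>2) + 3 * (Lf + LQ)\<^sup>2"

definition "R = C + C\<^sup>2 / w"

lemma \<alpha>_mono: "1 \<le> k \<Longrightarrow> \<alpha> (Suc k) \<le> \<alpha> k"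
  using c by (auto simp: \<alpha>_eq intro!: divide_left_mono)

lemma R_ge_C: "C \<le> R" and R_ge_1: "1 \<le> R"
proof -
  have "0 \<le> C\<^sup>2 / w" using w by simp
  then show "C \<le> R" "1 \<le> R" using C_ge_1 by (simp_all add: R_def)
qed

lemma BZ_le: "BZ \<le> 2 * D * LQ * R"
  using mult_left_mono[OF R_ge_C, of "2 * D * LQ"] D_nonneg[OF xs] LQ_nonneg by (simp add: B_Z_def mult_ac)

text \<open>With \<open>4 * LQ / w\<close> as kernel modulus, \<open>Lm\<close> contains
  \<open>10 * C + 12 * C\<^sup>2\<close>, at most \<open>22 * C\<^sup>2\<close> as \<open>C\<close>
  is at least 1; this is the 22 in \<open>H_const\<close>. The term free of \<open>C\<close> and
  \<open>w\<close> is absorbed through \<open>1 \<le> R\<close>.\<close>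

lemma H_le: "H \<le> H_const * R"
proof -
  have CC: "C \<le> C\<^sup>2" using C_ge_1 by (simp add: power2_eq_square)
  have "Lm = 2 * LQ * C + D * LQ\<^sup>2 * (10 * C + 12 * C\<^sup>2) / w"
    using w by (simp add: L_Z_def B_Z_def power2_eq_square field_simps)
  also have "\<dots> \<le> 2 * LQ * R + D * LQ\<^sup>2 * (22 * C\<^sup>2) / w"
    using CC R_ge_C LQ_nonneg w D_nonneg[OF xs]
    by (intro add_mono mult_left_mono divide_right_mono) auto
  also have "D * LQ\<^sup>2 * (22 * C\<^sup>2) / w = 22 * D * LQ\<^sup>2 * (C\<^sup>2 / w)" by simp
  also have "\<dots> \<le> 22 * D * LQ\<^sup>2 * R"
    using C_ge_1 D_nonneg[OF xs] by (intro mult_left_mono) (auto simp: R_def)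
  finally have "Lm \<le> (2 * LQ + 22 * D * LQ\<^sup>2) * R" by (simp add: algebra_simps)
  then have "2 * (Lf + LQ) * Lm \<le> 2 * (Lf + LQ) * ((2 * LQ + 22 * D * LQ\<^sup>2) * R)"
    using LQ_nonneg Lf_nonneg by (intro mult_left_mono) auto
  moreover have "3 * (Lf + LQ)\<^sup>2 * 1 \<le> 3 * (Lf + LQ)\<^sup>2 * R"
    using R_ge_1 by (intro mult_left_mono) auto
  ultimately show ?thesis unfolding H_def
    by (simp only: H_const_def distrib_right mult.assoc mult_1_right)
qed

lemma H_const_nonneg: "0 \<le> H_const"
  using LQ_nonneg Lf_nonneg D_nonneg[OF xs] by (simp add: H_const_def)

text \<open>From \<open>n = 2\<close> on, \<open>2 * l\<close> is at least 1 and absorbs the terms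
  without a logarithm; it also dominates \<open>ln (real n + 1)\<close>, since
  \<open>n + 1 \<le> n\<^sup>2\<close>. At \<open>n = 1\<close> the logarithm vanishes.\<close>

lemma step_average_rate:
  assumes n: "2 \<le> n"
  shows "expected_gap pr w M \<alpha> x n
    \<le> 2 * (D\<^sup>2 + 8 * D * LQ * c + H_const * c\<^sup>2) / c * R * (ln (real n) / sqrt (real n))"
proof -
  define l where "l = ln (real n)"
  define g where "g = expected_gap pr w M \<alpha> x n"
  have D: "0 \<le> D" by (rule D_nonneg[OF xs])
  have R: "0 \<le> R" using R_ge_1 by simp
  have g: "0 \<le> g" unfolding g_def using \<alpha>_pos n by (intro expected_gap_bounds(1)) auto
  have "ln 2 \<le> l" unfolding l_def using n by simp
  then have l: "1 \<le> 2 * l" using ln2_ge_two_thirds by linarith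
  have "real n + 1 \<le> (real n)\<^sup>2"
  proof -
    have n2: "2 \<le> real n" using n by simp
    then have "2 * real n \<le> real n * real n" by (intro mult_right_mono) auto
    then show ?thesis using n2 unfolding power2_eq_square by linarith
  qed
  then have "ln (real n + 1) \<le> ln ((real n)\<^sup>2)" using n by simp
  then have ln: "ln (real n + 1) \<le> 2 * l" using n by (simp add: ln_realpow l_def)
  have "(\<Sum>k=1..n. (\<alpha> k)\<^sup>2) = c\<^sup>2 * (\<Sum>k=1..n. 1 / (real k + 1))"
    unfolding sum_distrib_left by (intro sum.cong) (auto simp: \<alpha>_eq power_divide)
  also have "\<dots> \<le> c\<^sup>2 * (2 * l)"
    using sum_inverse_Suc_le_ln[of n] ln by (intro mult_left_mono) auto
  finally have sq: "(\<Sum>k=1..n. (\<alpha> k)\<^sup>2) \<le> c\<^sup>2 * (2 * l)" .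
  \<comment> \<open>The last step size is the smallest, so the sum is at least \<open>n\<close>
    times it; \<open>n + 1 \<le> 4 * n\<close> then costs a factor 2.\<close>
  have "c * sqrt (real n) \<le> 2 * (\<Sum>k=1..n. \<alpha> k)"
  proof -
    have "(\<Sum>k=1..n. \<alpha> n) \<le> (\<Sum>k=1..n. \<alpha> k)"
      using c by (intro sum_mono) (auto simp: \<alpha>_eq intro!: divide_left_mono)
    then have "real n * \<alpha> n \<le> (\<Sum>k=1..n. \<alpha> k)" by simp
    moreover have "sqrt (real n) / 2 \<le> real n / sqrt (real n + 1)"
    proof -
      have "sqrt (real n + 1) \<le> sqrt (4 * real n)" using n by simp
      then have "sqrt (real n) * sqrt (real n + 1) \<le> sqrt (real n) * (2 * sqrt (real n))"
        by (intro mult_left_mono) (auto simp: real_sqrt_mult)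
      moreover have "sqrt (real n) * (2 * sqrt (real n)) = 2 * real n" by simp
      ultimately have "sqrt (real n) * sqrt (real n + 1) \<le> 2 * real n" by linarith
      then show ?thesis by (simp add: field_simps)
    qed
    from mult_left_mono[OF this less_imp_le[OF c]] have "c * sqrt (real n) / 2 \<le> real n * \<alpha> n"
      using n by (simp add: \<alpha>_eq mult.commute)
    ultimately show ?thesis by simp
  qed
  then have "c * sqrt (real n) * g \<le> 2 * (\<Sum>k=1..n. \<alpha> k) * g"
    using g by (intro mult_right_mono)
  also have "\<dots> \<le> sqdist 0 + C_0 C D LQ (\<alpha> 1) + H * (\<Sum>k=1..n. (\<alpha> k)\<^sup>2)"
    unfolding g_def using n by (intro step_average_gap_le \<alpha>_mono) auto
  also have "\<dots> \<le> D\<^sup>2 * R * (2 * l) + 8 * D * LQ * c * R * (2 * l) + H_const * R * (c\<^sup>2 * (2 * l))"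
  proof (intro add_mono)
    have "1 * 1 \<le> R * (2 * l)" using R_ge_1 l by (intro mult_mono) auto
    then have "D\<^sup>2 * 1 \<le> D\<^sup>2 * (R * (2 * l))" by (intro mult_left_mono) auto
    then show "sqdist 0 \<le> D\<^sup>2 * R * (2 * l)" using sqdist_bounds[of 0] by (simp add: mult.assoc)
    have "\<alpha> 1 \<le> c" using c by (simp add: \<alpha>_eq divide_le_eq mult_le_cancel_left1)
    then have "4 * BZ * \<alpha> 1 \<le> 4 * (2 * D * LQ * R) * c"
      using BZ_le BZ_nonneg \<alpha>_pos[of 1] D LQ_nonneg R by (intro mult_mono) auto
    also have "\<dots> = 8 * D * LQ * c * R * 1" by simp
    also have "\<dots> \<le> 8 * D * LQ * c * R * (2 * l)"
      using l D LQ_nonneg c R by (intro mult_left_mono) auto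
    finally show "C_0 C D LQ (\<alpha> 1) \<le> 8 * D * LQ * c * R * (2 * l)" by (simp add: C_0_def)
    show "H * (\<Sum>k=1..n. (\<alpha> k)\<^sup>2) \<le> H_const * R * (c\<^sup>2 * (2 * l))"
      using H_le sq H_const_nonneg R by (intro mult_mono) (auto intro: sum_nonneg)
  qed
  also have "\<dots> = 2 * (D\<^sup>2 + 8 * D * LQ * c + H_const * c\<^sup>2) * R * l"
    by (simp add: algebra_simps)
  finally have "g * (c * sqrt (real n)) \<le> 2 * (D\<^sup>2 + 8 * D * LQ * c + H_const * c\<^sup>2) * R * l"
    by (simp add: mult_ac)
  then have "g \<le> 2 * (D\<^sup>2 + 8 * D * LQ * c + H_const * c\<^sup>2) * R * l / (c * sqrt (real n))"
    using c n by (subst pos_le_divide_eq) auto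
  then show ?thesis by (simp add: g_def l_def)
qed

text \<open>No logarithm arises: the weight \<open>k\<close> turns the harmonic sum of squared step
  sizes into a sum of terms \<open>k * \<alpha> k \<le> c * s\<close>. Every term on the right has a
  factor \<open>n * s\<close> against \<open>n * s * s\<close> on the left, which leaves
  \<open>1 / s\<close>.\<close>

lemma linear_average_rate:
  assumes n: "1 \<le> n"
  shows "expected_gap pr w M real x n \<le> (D\<^sup>2 / c + 8 * D * LQ + H_const * c) * R * (1 / sqrt (real n))"
proof -
  define g where "g = expected_gap pr w M real x n"
  define s where "s = sqrt (real n + 1)"
  define B where "B = (D\<^sup>2 / c + 8 * D * LQ + H_const * c) * R"
  have D: "0 \<le> D" by (rule D_nonneg[OF xs])
  have R: "0 \<le> R" using R_ge_1 by simp
  have s: "1 \<le> s" "s * s = real n + 1" by (auto simp: s_def)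
  have B: "0 \<le> B" using D LQ_nonneg c H_const_nonneg R by (simp add: B_def)
  have ka: "(\<Sum>k=1..n. real k * \<alpha> k) \<le> real n * (c * s)"
  proof -
    have "real k * \<alpha> k \<le> c * s" if "k \<in> {1..n}" for k
    proof -
      have "real k / sqrt (real k + 1) \<le> (real k + 1) / sqrt (real k + 1)"
        by (intro divide_right_mono) auto
      also have "\<dots> = sqrt (real k + 1)" by (simp add: real_div_sqrt)
      also have "\<dots> \<le> s" using that by (simp add: s_def)
      finally show ?thesis using that c by (simp add: \<alpha>_eq) (simp add: mult.commute pos_divide_le_eq)
    qed
    then have "(\<Sum>k=1..n. real k * \<alpha> k) \<le> (\<Sum>k=1..n. c * s)" by (rule sum_mono)
    then show ?thesis by simp
  qed
  have "real n * (s * s) * g \<le> real n / \<alpha> n * D\<^sup>2 + 4 * real n * BZ + H * (\<Sum>k=1..n. real k * \<alpha> k)"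
    unfolding g_def s(2) by (rule linear_average_gap_le[OF \<alpha>_mono n])
  also have "\<dots> \<le> real n * s * (D\<^sup>2 / c) * R + real n * s * (8 * D * LQ) * R + H_const * R * (real n * (c * s))"
  proof (intro add_mono)
    have "real n / \<alpha> n * D\<^sup>2 = real n * s * (D\<^sup>2 / c) * 1"
      using n c by (simp add: \<alpha>_eq s_def)
    also have "\<dots> \<le> real n * s * (D\<^sup>2 / c) * R"
      using s R_ge_1 c by (intro mult_left_mono) auto
    finally show "real n / \<alpha> n * D\<^sup>2 \<le> real n * s * (D\<^sup>2 / c) * R" .
    have "4 * real n * BZ \<le> 4 * real n * (2 * D * LQ * R)" using BZ_le by (intro mult_left_mono) auto
    also have "\<dots> = real n * 1 * (8 * D * LQ) * R" by simp
    also have "\<dots> \<le> real n * s * (8 * D * LQ) * R"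
      using s D LQ_nonneg R by (intro mult_right_mono mult_left_mono) auto
    finally show "4 * real n * BZ \<le> real n * s * (8 * D * LQ) * R" .
    show "H * (\<Sum>k=1..n. real k * \<alpha> k) \<le> H_const * R * (real n * (c * s))"
      using H_le ka H_const_nonneg R \<alpha>_pos by (intro mult_mono) (auto intro!: sum_nonneg simp: less_imp_le)
  qed
  also have "\<dots> = (real n * s) * B" by (simp add: B_def algebra_simps)
  finally have "(real n * s) * (s * g) \<le> (real n * s) * B" by (simp add: mult_ac)
  then have "s * g \<le> B" using n s by (subst (asm) mult_le_cancel_left_pos) auto
  then have "g \<le> B / s" using s by (subst pos_le_divide_eq) (auto simp: mult.commute)
  also have "\<dots> \<le> B / sqrt (real n)" using B n by (intro divide_left_mono) (auto simp: s_def)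
  finally show ?thesis by (simp add: g_def B_def)
qed

end

text \<open>The identity matrix has norm 1 in both operator norms, so \<kappa> is at least 1; its
  sign is what allows the given bound to be multiplied by it.\<close>

lemma opnorm_transfer:
  fixes N :: "real^'i::finite \<Rightarrow> real"
  assumes norm: "is_norm N" and kappa: "\<forall>A :: real^'i^'i. opnorm infnorm A \<le> \<kappa> * opnorm N A"
  shows "1 \<le> \<kappa>" and "opnorm N A \<le> C \<Longrightarrow> opnorm infnorm A \<le> \<kappa> * C"
proof -
  show \<kappa>: "1 \<le> \<kappa>"
    using kappa[rule_format, of "mat 1"] by (simp add: opnorm_mat_1 norm is_norm_infnorm)
  show "opnorm infnorm A \<le> \<kappa> * C" if "opnorm N A \<le> C"
    using kappa[rule_format, of A] mult_left_mono[OF that, of \<kappa>] \<kappa> by linarith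
qed

theorem theorem1:
  fixes N :: "real^'i::finite \<Rightarrow> real" and \<kappa> D Lf LQ :: real
  assumes norm: "is_norm N"
    and kappa: "\<forall>A :: real^'i^'i. opnorm infnorm A \<le> \<kappa> * opnorm N A"
  shows
    "(\<forall>(pr :: ('x::finite, 'z::finite, 'y::finite, 'm::finite, 'i) problem) w C LP \<alpha>
        (M :: 'w measure) \<F> x I xstar n.
        standing pr D Lf LQ \<and> 0 < w \<and> 0 < C \<and>
        (\<forall>z\<in>feas pr. opnorm N (fundamental_matrix pr w z) \<le> C) \<and>
        kernel_lipschitz pr w LP \<and>
        (\<forall>k\<ge>1. 0 < \<alpha> k) \<and> (\<forall>k\<ge>1. \<alpha> (Suc k) \<le> \<alpha> k) \<and>
        method_run pr w \<alpha> M \<F> x I \<and>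
        is_arg_min (surrogate pr w) (\<lambda>z. z \<in> feas pr) xstar \<and> 1 \<le> n
        \<longrightarrow>
        0 \<le> expected_gap pr w M real x n \<and>
        0 \<le> expected_gap pr w M \<alpha> x n \<and>
        expected_gap pr w M \<alpha> x n \<le>
          ((\<integral>\<omega>. (norm (x 0 \<omega> - xstar))\<^sup>2 \<partial>M) + C_0 (\<kappa> * C) D LQ (\<alpha> 1)
             + (C_1 (\<kappa> * C) D Lf LQ LP w + 3 * (Lf + LQ)\<^sup>2) * (\<Sum>k=1..n. (\<alpha> k)\<^sup>2))
          / (2 * (\<Sum>k=1..n. \<alpha> k)))
     \<and>
     (\<forall>c>0. \<exists>K. \<forall>(pr :: ('x, 'z, 'y, 'm, 'i) problem) w C \<alpha> (M :: 'w measure) \<F> x I.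
        standing pr D Lf LQ \<and> 0 < w \<and> 0 < C \<and>
        (\<forall>z\<in>feas pr. opnorm N (fundamental_matrix pr w z) \<le> C) \<and>
        (\<forall>k\<ge>1. \<alpha> k = c / sqrt (real k + 1)) \<and>
        method_run pr w \<alpha> M \<F> x I
        \<longrightarrow>
        (\<forall>n\<ge>2. \<bar>expected_gap pr w M \<alpha> x n\<bar> \<le> K * ((C + C\<^sup>2 / w) * (ln (real n) / sqrt (real n)))) \<and>
        (\<forall>n\<ge>1. \<bar>expected_gap pr w M real x n\<bar> \<le> K * ((C + C\<^sup>2 / w) * (1 / sqrt (real n)))))"
proof (intro conjI allI impI)
  fix pr :: "('x, 'z, 'y, 'm, 'i) problem" and w C LP \<alpha> and M :: "'w measure" and \<F> x I xstar and n :: nat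
  assume hyp: "standing pr D Lf LQ \<and> 0 < w \<and> 0 < C \<and>
        (\<forall>z\<in>feas pr. opnorm N (fundamental_matrix pr w z) \<le> C) \<and>
        kernel_lipschitz pr w LP \<and>
        (\<forall>k\<ge>1. 0 < \<alpha> k) \<and> (\<forall>k\<ge>1. \<alpha> (Suc k) \<le> \<alpha> k) \<and>
        method_run pr w \<alpha> M \<F> x I \<and>
        is_arg_min (surrogate pr w) (\<lambda>z. z \<in> feas pr) xstar \<and> 1 \<le> n"
  interpret soft_separation_run pr w D Lf LQ "\<kappa> * C" LP xstar \<alpha> M \<F> x I
    by unfold_locales
      (use hyp opnorm_transfer(2)[OF norm kappa] in \<open>auto simp: is_arg_min_linorder\<close>)
  have \<alpha>: "\<And>k. 1 \<le> k \<Longrightarrow> 0 < \<alpha> k" and mono: "\<And>k. 1 \<le> k \<Longrightarrow> \<alpha> (Suc k) \<le> \<alpha> k" and n: "1 \<le> n"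
    using hyp by auto
  show "0 \<le> expected_gap pr w M real x n" "0 \<le> expected_gap pr w M \<alpha> x n"
    using \<alpha> n by (auto intro!: expected_gap_bounds(1))
  have S: "0 < 2 * (\<Sum>k=1..n. \<alpha> k)" using \<alpha> n by (intro mult_pos_pos sum_pos) auto
  have C1: "C_1 (\<kappa> * C) D Lf LQ LP w = 2 * (Lf + LQ) * Lm" by (simp add: C_1_def add.commute)
  show "expected_gap pr w M \<alpha> x n \<le>
          ((\<integral>\<omega>. (norm (x 0 \<omega> - xstar))\<^sup>2 \<partial>M) + C_0 (\<kappa> * C) D LQ (\<alpha> 1)
             + (C_1 (\<kappa> * C) D Lf LQ LP w + 3 * (Lf + LQ)\<^sup>2) * (\<Sum>k=1..n. (\<alpha> k)\<^sup>2))
          / (2 * (\<Sum>k=1..n. \<alpha> k))"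
    using step_average_gap_le[OF mono n] unfolding pos_le_divide_eq[OF S] C1 sqdist_def H_def
    by (simp add: mult.commute)
next
  fix c :: real assume c: "0 < c"
  \<comment> \<open>The value of \<open>H_const\<close>, written out before problem, temperature and
    run are fixed: \<open>K\<close> may depend only on \<open>D\<close>, \<open>Lf\<close>,
    \<open>LQ\<close> and \<open>c\<close>.\<close>
  define H' where "H' = 2 * (Lf + LQ) * (2 * LQ + 22 * D * LQ\<^sup>2) + 3 * (Lf + LQ)\<^sup>2"
  define K where "K = max (2 * (D\<^sup>2 + 8 * D * LQ * c + H' * c\<^sup>2) / c) (D\<^sup>2 / c + 8 * D * LQ + H' * c)"
  show "\<exists>K. \<forall>(pr :: ('x, 'z, 'y, 'm, 'i) problem) w C \<alpha> (M :: 'w measure) \<F> x I.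
        standing pr D Lf LQ \<and> 0 < w \<and> 0 < C \<and>
        (\<forall>z\<in>feas pr. opnorm N (fundamental_matrix pr w z) \<le> C) \<and>
        (\<forall>k\<ge>1. \<alpha> k = c / sqrt (real k + 1)) \<and>
        method_run pr w \<alpha> M \<F> x I
        \<longrightarrow>
        (\<forall>n\<ge>2. \<bar>expected_gap pr w M \<alpha> x n\<bar> \<le> K * ((C + C\<^sup>2 / w) * (ln (real n) / sqrt (real n)))) \<and>
        (\<forall>n\<ge>1. \<bar>expected_gap pr w M real x n\<bar> \<le> K * ((C + C\<^sup>2 / w) * (1 / sqrt (real n))))"
  \<comment> \<open>The factor \<open>\<kappa>\<^sup>2\<close> appears because \<open>R\<close> is
    formed with \<open>\<kappa> * C\<close>, and \<open>1 \<le> \<kappa>\<close> lets the linear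
    term be enlarged to the same power.\<close>
  proof (intro exI[of _ "K * \<kappa>\<^sup>2"] allI impI)
    fix pr :: "('x, 'z, 'y, 'm, 'i) problem" and w C \<alpha> and M :: "'w measure" and \<F> x I
    assume hyp: "standing pr D Lf LQ \<and> 0 < w \<and> 0 < C \<and>
        (\<forall>z\<in>feas pr. opnorm N (fundamental_matrix pr w z) \<le> C) \<and>
        (\<forall>k\<ge>1. \<alpha> k = c / sqrt (real k + 1)) \<and>
        method_run pr w \<alpha> M \<F> x I"
    interpret s: soft_separation pr w D Lf LQ
      by unfold_locales (use hyp in auto)
    interpret M: prob_space M using hyp by (simp add: method_run_def)
    \<comment> \<open>No minimiser is given in this part. The initial point of some outcome shows
      that the feasible set is nonempty; compactness and continuity of the surrogate then provide
      one.\<close>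
    obtain \<omega> where "\<omega> \<in> space M" using M.not_empty by blast
    then have "feas pr \<noteq> {}" using hyp by (auto simp: method_run_def)
    moreover have "compact (feas pr)" using hyp by (simp add: standing_def)
    ultimately obtain xs where xs: "xs \<in> feas pr" "\<And>u. u \<in> feas pr \<Longrightarrow> surrogate pr w xs \<le> surrogate pr w u"
      using continuous_attains_inf lipschitz_on_continuous_on[OF s.surrogate_lipschitz] by metis
    interpret soft_separation_rate pr w D Lf LQ "\<kappa> * C" xs \<alpha> M \<F> x I c
      by unfold_locales
        (use hyp opnorm_transfer(2)[OF norm kappa] xs c s.kernel_lipschitz_explicit in auto)
    have H': "H_const = H'" by (simp add: H_const_def H'_def)
    have R0: "0 \<le> R" using R_ge_1 by simp
    have K0: "0 \<le> K"
      using s.D_nonneg[OF xs(1)] s.LQ_nonneg c H_const_nonneg by (simp add: K_def H' le_max_iff_disj)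
    have "\<kappa> * C \<le> \<kappa>\<^sup>2 * C"
      using opnorm_transfer(1)[OF norm kappa] hyp by (simp add: power2_eq_square)
    then have R: "R \<le> \<kappa>\<^sup>2 * (C + C\<^sup>2 / w)"
      by (simp add: R_def distrib_left power_mult_distrib)
    have le: "B * R * t \<le> K * \<kappa>\<^sup>2 * ((C + C\<^sup>2 / w) * t)" if "B \<le> K" "0 \<le> t" for B t
    proof -
      have "B * R * t \<le> K * R * t" using that R0 by (intro mult_right_mono) auto
      also have "\<dots> \<le> K * (\<kappa>\<^sup>2 * (C + C\<^sup>2 / w)) * t" using that R K0 by (intro mult_right_mono mult_left_mono) auto
      finally show ?thesis by (simp add: mult_ac)
    qed
    have "\<bar>expected_gap pr w M \<alpha> x n\<bar> \<le> K * \<kappa>\<^sup>2 * ((C + C\<^sup>2 / w) * (ln (real n) / sqrt (real n)))" if "2 \<le> n" for n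
    proof -
      have "0 \<le> expected_gap pr w M \<alpha> x n"
        using \<alpha>_pos that by (intro expected_gap_bounds(1)) auto
      moreover note step_average_rate[OF that]
      moreover have "2 * (D\<^sup>2 + 8 * D * LQ * c + H_const * c\<^sup>2) / c * R * (ln (real n) / sqrt (real n))
          \<le> K * \<kappa>\<^sup>2 * ((C + C\<^sup>2 / w) * (ln (real n) / sqrt (real n)))"
        by (rule le) (use that in \<open>auto simp: K_def H'\<close>)
      ultimately show ?thesis by linarith
    qed
    moreover have "\<bar>expected_gap pr w M real x n\<bar> \<le> K * \<kappa>\<^sup>2 * ((C + C\<^sup>2 / w) * (1 / sqrt (real n)))" if "1 \<le> n" for n
    proof -
      have "0 \<le> expected_gap pr w M real x n"
        using that by (intro expected_gap_bounds(1)) auto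
      moreover note linear_average_rate[OF that]
      moreover have "(D\<^sup>2 / c + 8 * D * LQ + H_const * c) * R * (1 / sqrt (real n))
          \<le> K * \<kappa>\<^sup>2 * ((C + C\<^sup>2 / w) * (1 / sqrt (real n)))"
        by (rule le) (auto simp: K_def H')
      ultimately show ?thesis by linarith
    qed
    ultimately show "(\<forall>n\<ge>2. \<bar>expected_gap pr w M \<alpha> x n\<bar> \<le> K * \<kappa>\<^sup>2 * ((C + C\<^sup>2 / w) * (ln (real n) / sqrt (real n)))) \<and>
        (\<forall>n\<ge>1. \<bar>expected_gap pr w M real x n\<bar> \<le> K * \<kappa>\<^sup>2 * ((C + C\<^sup>2 / w) * (1 / sqrt (real n))))"
      by blast
  qed
qed

end
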